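(* Let $p \in \mathbb N$ and let $I$ be an ideal such that every sequence in the characteristic set $\Sigma(I)$ is dominated termwise by some $\eta\in\Sigma(I)$ that satisfies the $p$-th order exponential $\Delta_2$-condition $$\sup_{m}\,\frac{m^2(\eta_{a^p})_{m^2}}{m(\eta_{a^p})_m} < \infty .$$ Then for every ideal $J$: $J_{a^{p+1}} \supset I_{a^{p+1}}$ implies $J_{a^p} \supset I_{a^p}$; $J_{a^{p+1}} \subset I_{a^{p+1}}$ implies $J_{a^p} \subset I_{a^p}$; and $J_{a^{p+1}} = I_{a^{p+1}}$ implies $J_{a^p} = I_{a^p}$.
   Context: $H$ is an infinite-dimensional separable complex Hilbert space and $B(H)$ is the algebra of bounded operators on it. $\text{c}_{\text{o}}^*$ is the set of nonnegative real sequences $\xi = (\xi_n)_{n\ge 1}$ that are nonincreasing and converge to $0$. For $m \in \mathbb N$, the ampliation $D_m\xi$ is the sequence in which each entry of $\xi$ is repeated $m$ times. A characteristic set is a positive cone $\Sigma \subset \text{c}_{\text{o}}^*$ (closed under sums and nonnegative scalar multiples) that is hereditary ($0\le\eta \le \xi\in\Sigma$, $\eta\in \text{c}_{\text{o}}^*$, implies $\eta \in \Sigma$) and invariant under all $D_m$. By Calkin's theorem, $I \mapsto \Sigma(I) := \{s(X) \mid X \in I\}$, with $s(X)$ the sequence of $s$-numbers (singular values) of $X$ in decreasing order with multiplicity, completed by zeros if $X$ has finite rank, is an order-preserving bijection from the (proper, two-sided) ideals of $B(H)$ onto the characteristic sets; "ideal" means such an ideal. For $\xi\in \text{c}_{\text{o}}^*$,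 $(\xi_a)_n := \frac1n\sum_{j=1}^n \xi_j$, and $\xi_{a^p}$ is the sequence obtained by applying $\xi\mapsto\xi_a$ $p$ times. The arithmetic mean ideal $I_a$ of an ideal $I$ is the ideal with $\Sigma(I_a) = \{\xi \in \text{c}_{\text{o}}^* \mid \xi = O(\eta_a) \text{ for some } \eta\in\Sigma(I)\}$, and $I_{a^p}$ is obtained by applying $I\mapsto I_a$ $p$ times. The dominating sequences $\eta$ are nonzero, so that the quotients in the condition are defined. *)

theory Defs
  imports "HOL-Analysis.Analysis"
begin

section \<open>Complex Hilbert spaces\<close>

text \<open>
  A complex Hilbert space, with its canonical underlying real Hilbert space structure: the norm is
  the one given by the real inner product \<open>Re (cinner x y)\<close>. The complex inner product is linear in
  its first argument. Positive definiteness is inherited from the real inner product, since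
  \<open>cinner x x\<close> is real by \<open>cinner_commute\<close>.
\<close>

class complex_hilbert = real_inner + banach +
  fixes scaleC :: "complex \<Rightarrow> 'a \<Rightarrow> 'a" (infixr "*\<^sub>C" 75)
    and cinner :: "'a \<Rightarrow> 'a \<Rightarrow> complex"
  assumes scaleC_add_right: "c *\<^sub>C (x + y) = c *\<^sub>C x + c *\<^sub>C y"
    and scaleC_add_left: "(c + d) *\<^sub>C x = c *\<^sub>C x + d *\<^sub>C x"
    and scaleC_scaleC: "c *\<^sub>C (d *\<^sub>C x) = (c * d) *\<^sub>C x"
    and scaleC_one: "1 *\<^sub>C x = x"
    and scaleR_scaleC: "scaleR r x = complex_of_real r *\<^sub>C x"
    and cinner_commute: "cinner y x = cnj (cinner x y)"
    and cinner_add_left: "cinner (x + y) z = cinner x z + cinner y z"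
    and cinner_scaleC_left: "cinner (c *\<^sub>C x) y = c * cinner x y"
    and inner_eq_Re_cinner: "inner x y = Re (cinner x y)"

interpretation complex_vector:
  vector_space "scaleC :: complex \<Rightarrow> 'a \<Rightarrow> 'a::complex_hilbert"
  by unfold_locales
    (simp_all add: scaleC_add_right scaleC_add_left scaleC_scaleC scaleC_one)

definition infinite_dimensional :: "'a::complex_hilbert itself \<Rightarrow> bool" where
  "infinite_dimensional _ \<longleftrightarrow> \<not> (\<exists>B :: 'a set. finite B \<and> complex_vector.span B = UNIV)"

definition separable :: "'a::topological_space itself \<Rightarrow> bool" where
  "separable _ \<longleftrightarrow> (\<exists>D :: 'a set. countable D \<and> closure D = UNIV)"


section \<open>Bounded operators and ideals\<close>

definition bounded_operators :: "('a::complex_hilbert \<Rightarrow> 'a) set" where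
  "bounded_operators = {X. bounded_linear X \<and> (\<forall>c x. X (c *\<^sub>C x) = c *\<^sub>C X x)}"

definition adjoint_operator :: "('a::complex_hilbert \<Rightarrow> 'a) \<Rightarrow> 'a \<Rightarrow> 'a" where
  "adjoint_operator X =
     (THE Y. Y \<in> bounded_operators \<and> (\<forall>x y. cinner (X x) y = cinner x (Y y)))"

text \<open>
  Closure under scalar multiples and negation is the multiplication by multiples of the identity.
\<close>

definition operator_ideal :: "('a::complex_hilbert \<Rightarrow> 'a) set \<Rightarrow> bool" where
  "operator_ideal I \<longleftrightarrow>
     I \<subseteq> bounded_operators \<and> I \<noteq> bounded_operators \<and>
     (\<lambda>x. 0) \<in> I \<and>
     (\<forall>X\<in>I. \<forall>Y\<in>I. (\<lambda>x. X x + Y x) \<in> I) \<and>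
     (\<forall>X\<in>I. \<forall>A\<in>bounded_operators. A \<circ> X \<in> I \<and> X \<circ> A \<in> I)"


section \<open>Sequences, s-numbers and arithmetic means\<close>

text \<open>
  Sequences are indexed from 0: the entry \<open>\<xi> n\<close> is the \<open>(n + 1)\<close>-st term of the sequence.
\<close>

definition c0_star :: "(nat \<Rightarrow> real) set" where
  "c0_star = {\<xi>. (\<forall>n. 0 \<le> \<xi> n) \<and> decseq \<xi> \<and> \<xi> \<longlonglongrightarrow> 0}"

text \<open>
  The singular values of \<open>X\<close> are the square roots of the eigenvalues of \<open>X\<^sup>*X\<close>; each positive one
  occurs in the sequence as often as its multiplicity says. A sequence in \<open>c0_star\<close> is determined
  by how often it takes each positive value, which also accounts for the completion by zeros. For
  a compact operator, hence for every element of a proper ideal of operators on a separable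
  infinite-dimensional space, such a sequence exists.
\<close>

definition s_numbers :: "('a::complex_hilbert \<Rightarrow> 'a) \<Rightarrow> nat \<Rightarrow> real" where
  "s_numbers X =
     (THE \<xi>. \<xi> \<in> c0_star \<and>
        (\<forall>\<sigma>>0. card {n. \<xi> n = \<sigma>} =
           complex_vector.dim
             {x. adjoint_operator X (X x) = complex_of_real (\<sigma>\<^sup>2) *\<^sub>C x}))"

definition characteristic_set :: "('a::complex_hilbert \<Rightarrow> 'a) set \<Rightarrow> (nat \<Rightarrow> real) set" where
  "characteristic_set I = s_numbers ` I"

definition arith_mean :: "(nat \<Rightarrow> real) \<Rightarrow> nat \<Rightarrow> real" where
  "arith_mean \<xi> n = (\<Sum>j\<le>n. \<xi> j) / real (n + 1)"

text \<open>
  The bound \<open>\<xi> = O(\<eta>\<^sub>a)\<close> is required at every index, not just eventually. This matters only for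
  \<open>\<eta> = 0\<close>, where it forces \<open>\<xi> = 0\<close>: otherwise \<open>\<eta>\<^sub>a\<close> is positive everywhere and the two agree.
\<close>

definition arith_mean_ideal :: "('a::complex_hilbert \<Rightarrow> 'a) set \<Rightarrow> ('a \<Rightarrow> 'a) set" where
  "arith_mean_ideal I =
     (THE K. operator_ideal K \<and>
        characteristic_set K =
          {\<xi> \<in> c0_star. \<exists>\<eta>\<in>characteristic_set I. \<exists>C. \<forall>n. \<xi> n \<le> C * arith_mean \<eta> n})"

text \<open>
  In the exponential \<open>\<Delta>\<^sub>2\<close>-condition \<open>m \<ge> 1\<close> counts from 1, hence the index shifts.
\<close>

definition exp_Delta2 :: "nat \<Rightarrow> (nat \<Rightarrow> real) \<Rightarrow> bool" where
  "exp_Delta2 p \<eta> \<longleftrightarrow>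
     bdd_above ((\<lambda>m. (real (m\<^sup>2) * (arith_mean ^^ p) \<eta> (m\<^sup>2 - 1)) /
                      (real m * (arith_mean ^^ p) \<eta> (m - 1))) ` {1..})"

end

theory Submission
  imports Defs
begin

text \<open>
  Calkin's theorem turns the assertion about ideals into one about sequences: an ideal is
  determined by its characteristic set, inclusions correspond to inclusions, and the
  characteristic set of \<open>I\<close> averaged \<open>p\<close> times consists of the sequences in \<open>c0_star\<close> that
  are \<open>O\<close> of the \<open>p\<close>-fold mean of some \<open>\<eta>\<close> in the characteristic set of \<open>I\<close>. The theorem
  then says that one arithmetic mean can be cancelled in an inequality between iterated
  means if one of the two sequences satisfies the exponential \<open>\<Delta>\<^sub>2\<close>-condition.

  Cancellation of a mean. Let \<open>S\<close> and \<open>T\<close> be the partial sums of the \<open>(p - 1)\<close>-fold means of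
  two sequences, so that \<open>S\<^sub>m / m\<close> and \<open>T\<^sub>m / m\<close> are their \<open>p\<close>-fold means. An inequality
  between the \<open>(p + 1)\<close>-fold means says \<open>\<Sum>\<^sub>m T\<^sub>m / m \<le> C \<Sum>\<^sub>m S\<^sub>m / m\<close> for the sums over
  \<open>m \<le> n\<close>, for every \<open>n\<close>. Take \<open>n = k\<^sup>2\<close>. As \<open>T\<close> and \<open>S\<close> increase, the left-hand side is at
  least \<open>T\<^sub>k\<close> times \<open>\<Sum> 1/m\<close> over \<open>k < m \<le> k\<^sup>2\<close>, which is about \<open>log k\<close>, and the right-hand
  side is at most the value of \<open>C S\<close> at \<open>k\<^sup>2\<close> times about \<open>2 log k\<close>. Hence \<open>T(k) \<le> D S(k\<^sup>2)\<close>
  (\<open>weighted_sums_comparison\<close>). The exponential \<open>\<Delta>\<^sub>2\<close>-condition says precisely that the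
  partial sums of the good sequence satisfy \<open>S(k\<^sup>2) \<le> K S(k)\<close>, and this removes the square,
  whichever side of the inequality the good sequence is on (\<open>mean_le_cancel_left\<close>,
  \<open>mean_le_cancel_right\<close>).

  Calkin's theorem. An operator in a proper ideal is compact, because otherwise it could be
  inverted on an infinite-dimensional subspace and the identity would lie in the ideal
  (\<open>ideal_small_off_finite\<close>). A compact operator has a Schmidt decomposition
  \<open>\<Sum> \<xi>\<^sub>n \<langle>\<cdot>, u\<^sub>n\<rangle> v\<^sub>n\<close>, found by maximising the norm repeatedly on orthogonal complements
  (\<open>Schmidt_decomposition\<close>), and \<open>\<xi>\<close> is its sequence of s-numbers. Multiplying by partial
  isometries shows that the operator lies in an ideal exactly if the diagonal operator with
  entries \<open>\<xi>\<close> does, so the ideal is determined by its diagonal operators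
  (\<open>ideal_subset_iff\<close>). Conversely, a characteristic set \<open>\<Sigma>\<close> is realised by the operators
  that factor through the diagonal operator of some member of \<open>\<Sigma>\<close>. Sums stay in this class
  because two diagonal operators side by side form a diagonal operator of an ampliation
  (\<open>calkin_ideal_add\<close>), and a minimax argument shows that no new diagonal operators appear
  (\<open>diagonal_factor_le\<close>).
\<close>

section \<open>The complex inner product\<close>

lemma cinner_add_right: "cinner x (y + z) = cinner x y + cinner x (z::'a::complex_hilbert)"
  by (metis cinner_add_left cinner_commute complex_cnj_add)

lemma cinner_scaleC_right: "cinner x (c *\<^sub>C y) = cnj c * cinner x (y::'a::complex_hilbert)"
  by (metis cinner_commute cinner_scaleC_left complex_cnj_mult)

lemma cinner_self: "cinner x x = complex_of_real ((norm (x::'a::complex_hilbert))\<^sup>2)"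
proof -
  have "Im (cinner x x) = 0" using cinner_commute[of x x] by (simp add: complex_eq_iff)
  moreover have "Re (cinner x x) = (norm x)\<^sup>2"
    by (metis inner_eq_Re_cinner power2_norm_eq_inner)
  ultimately show ?thesis by (simp add: complex_eq_iff)
qed

lemma norm_scaleC: "norm (c *\<^sub>C (x::'a::complex_hilbert)) = cmod c * norm x"
proof -
  have "complex_of_real ((norm (c *\<^sub>C x))\<^sup>2) = c * cnj c * complex_of_real ((norm x)\<^sup>2)"
    by (simp only: cinner_self[symmetric] cinner_scaleC_left cinner_scaleC_right) (simp add: mult_ac)
  also have "\<dots> = complex_of_real ((cmod c * norm x)\<^sup>2)"
    by (simp add: complex_norm_square[symmetric] power_mult_distrib)
  finally have "(norm (c *\<^sub>C x))\<^sup>2 = (cmod c * norm x)\<^sup>2" using of_real_eq_iff by blast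
  then show ?thesis by (simp add: power2_eq_iff_nonneg)
qed

lemma cinner_Cauchy_Schwarz: "cmod (cinner x y) \<le> norm x * norm (y::'a::complex_hilbert)"
proof (cases "cinner x y = 0")
  case False
  \<comment> \<open>The phase that turns the complex inner product into its modulus, so that the real inequality applies.\<close>
  define c where "c = cnj (cinner x y) / cmod (cinner x y)"
  have c1: "cmod c = 1" using False by (simp add: c_def norm_divide)
  have "c * cinner x y = cmod (cinner x y)"
    using False by (simp add: c_def complex_norm_square[symmetric] mult.commute power2_eq_square)
  then have "cmod (cinner x y) = Re (cinner (c *\<^sub>C x) y)" by (simp add: cinner_scaleC_left)
  also have "\<dots> = inner (c *\<^sub>C x) y" by (simp add: inner_eq_Re_cinner)
  also have "\<dots> \<le> norm (c *\<^sub>C x) * norm y" by (rule norm_cauchy_schwarz)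
  finally show ?thesis by (simp add: norm_scaleC c1)
qed simp

interpretation cinner: bounded_bilinear "cinner :: 'a::complex_hilbert \<Rightarrow> 'a \<Rightarrow> complex"
proof
  show "\<exists>K. \<forall>a b::'a. norm (cinner a b) \<le> norm a * norm b * K"
    using cinner_Cauchy_Schwarz by (intro exI[of _ 1]) auto
qed (auto simp: cinner_add_left cinner_add_right scaleR_scaleC cinner_scaleC_left
    cinner_scaleC_right scaleR_conv_of_real)

declare cinner.zero_left [simp] cinner.zero_right [simp]

interpretation scaleC: bounded_bilinear "scaleC :: complex \<Rightarrow> 'a::complex_hilbert \<Rightarrow> 'a"
proof
  show "\<exists>K. \<forall>a. \<forall>b::'a. norm (a *\<^sub>C b) \<le> norm a * norm b * K"
    by (intro exI[of _ 1]) (auto simp: norm_scaleC)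
qed (auto simp: scaleC_add_left scaleC_add_right scaleR_scaleC scaleC_scaleC
    scaleR_conv_of_real mult.commute)

lemma cinner_eq_0_commute: "cinner x y = 0 \<longleftrightarrow> cinner y (x::'a::complex_hilbert) = 0"
  by (metis cinner_commute complex_cnj_zero_iff)

lemma cinner_ext:
  assumes "\<And>y. cinner x y = cinner x' (y::'a::complex_hilbert)" shows "x = x'"
proof -
  have "cinner (x - x') (x - x') = 0" by (simp add: cinner.diff_left assms)
  then show ?thesis by (simp add: cinner_self)
qed

lemma norm_add_orthogonal:
  assumes "cinner x (y::'a::complex_hilbert) = 0"
  shows "(norm (x + y))\<^sup>2 = (norm x)\<^sup>2 + (norm y)\<^sup>2"
proof -
  have "inner x y = 0" using assms by (simp add: inner_eq_Re_cinner)
  then show ?thesis by (simp add: power2_norm_eq_inner inner_add_left inner_add_right inner_commute)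
qed

section \<open>Orthogonal families\<close>

text \<open>
  Only orthogonality and \<open>\<parallel>u\<^sub>i\<parallel> \<le> 1\<close> are asked for, so that zero vectors are allowed: a
  Schmidt series of an operator whose range is small has no natural second orthonormal
  family to offer at the indices where the singular value is zero.
\<close>

definition orthogonal_contractions :: "('i \<Rightarrow> 'a::complex_hilbert) \<Rightarrow> 'i set \<Rightarrow> bool" where
  "orthogonal_contractions u S \<longleftrightarrow>
     (\<forall>i\<in>S. norm (u i) \<le> 1) \<and> (\<forall>i\<in>S. \<forall>j\<in>S. i \<noteq> j \<longrightarrow> cinner (u i) (u j) = 0)"

definition orthonormal :: "('i \<Rightarrow> 'a::complex_hilbert) \<Rightarrow> 'i set \<Rightarrow> bool" where
  "orthonormal u S \<longleftrightarrow>
     (\<forall>i\<in>S. norm (u i) = 1) \<and> (\<forall>i\<in>S. \<forall>j\<in>S. i \<noteq> j \<longrightarrow> cinner (u i) (u j) = 0)"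

lemma orthonormal_imp_contractions: "orthonormal u S \<Longrightarrow> orthogonal_contractions u S"
  by (auto simp: orthonormal_def orthogonal_contractions_def)

lemma orthogonal_contractions_subset:
  "orthogonal_contractions u S \<Longrightarrow> T \<subseteq> S \<Longrightarrow> orthogonal_contractions u T"
  by (auto simp: orthogonal_contractions_def)

lemma orthonormal_subset: "orthonormal u S \<Longrightarrow> T \<subseteq> S \<Longrightarrow> orthonormal u T"
  by (auto simp: orthonormal_def)

lemma cinner_sum_orthogonal:
  assumes "orthogonal_contractions u S" "finite S" "j \<in> S"
  shows "cinner (\<Sum>i\<in>S. c i *\<^sub>C u i) (u j) = c j * complex_of_real ((norm (u j))\<^sup>2)"
proof -
  have "cinner (\<Sum>i\<in>S. c i *\<^sub>C u i) (u j) = (\<Sum>i\<in>S. c i * cinner (u i) (u j))"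
    by (simp add: cinner.sum_left cinner_scaleC_left)
  also have "\<dots> = (\<Sum>i\<in>S. if i = j then c j * cinner (u j) (u j) else 0)"
    using assms by (intro sum.cong) (auto simp: orthogonal_contractions_def)
  finally show ?thesis using assms by (simp add: cinner_self)
qed

lemma norm_sum_orthogonal:
  assumes "orthogonal_contractions u S" "finite S"
  shows "(norm (\<Sum>i\<in>S. c i *\<^sub>C u i))\<^sup>2 = (\<Sum>i\<in>S. (cmod (c i))\<^sup>2 * (norm (u i))\<^sup>2)"
  using assms(2,1)
proof (induction S rule: finite_induct)
  case (insert j S)
  have "orthogonal_contractions u S" using insert.prems by (rule orthogonal_contractions_subset) auto
  moreover have "cinner (c j *\<^sub>C u j) (\<Sum>i\<in>S. c i *\<^sub>C u i) = 0"
    unfolding cinner.sum_right using insert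
    by (intro sum.neutral) (auto simp: cinner_scaleC_left cinner_scaleC_right orthogonal_contractions_def)
  ultimately show ?case
    using insert by (simp add: norm_add_orthogonal norm_scaleC power_mult_distrib)
qed simp

lemma norm_sum_orthogonal_le:
  assumes "orthogonal_contractions u S" "finite S"
  shows "(norm (\<Sum>i\<in>S. c i *\<^sub>C u i))\<^sup>2 \<le> (\<Sum>i\<in>S. (cmod (c i))\<^sup>2)"
  unfolding norm_sum_orthogonal[OF assms]
  using assms by (intro sum_mono) (auto simp: orthogonal_contractions_def intro!: mult_right_le_one_le power_le_one)

text \<open>
  Expand \<open>0 \<le> \<parallel>x - y\<parallel>\<^sup>2\<close> for \<open>y = \<Sum> \<langle>x, u\<^sub>i\<rangle> u\<^sub>i\<close>: with \<open>s = \<Sum> |\<langle>x, u\<^sub>i\<rangle>|\<^sup>2\<close> the mixed term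
  is \<open>\<langle>x, y\<rangle> = s\<close> and \<open>\<parallel>y\<parallel>\<^sup>2 \<le> s\<close>, because the \<open>u\<^sub>i\<close> are orthogonal contractions.
\<close>

lemma Bessel_finite:
  assumes "orthogonal_contractions u S" "finite S"
  shows "(\<Sum>i\<in>S. (cmod (cinner x (u i)))\<^sup>2) \<le> (norm x)\<^sup>2"
proof -
  define s where "s = (\<Sum>i\<in>S. (cmod (cinner x (u i)))\<^sup>2)"
  define y where "y = (\<Sum>i\<in>S. cinner x (u i) *\<^sub>C u i)"
  have "cinner x y = complex_of_real s"
    by (simp add: y_def s_def cinner.sum_right cinner_scaleC_right complex_norm_square mult.commute
        del: of_real_power)
  then have "inner x y = s" by (simp add: inner_eq_Re_cinner)
  moreover have "(norm y)\<^sup>2 \<le> s" unfolding y_def s_def by (rule norm_sum_orthogonal_le[OF assms])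
  moreover have "0 \<le> (norm (x - y))\<^sup>2" by simp
  ultimately show ?thesis
    unfolding s_def[symmetric]
    by (simp add: power2_norm_eq_inner inner_diff_left inner_diff_right inner_commute)
qed

lemma orthogonal_residual:
  assumes "orthonormal u S" "finite S" "j \<in> S"
  shows "cinner (x - (\<Sum>i\<in>S. cinner x (u i) *\<^sub>C u i)) (u j) = 0"
  using cinner_sum_orthogonal[OF orthonormal_imp_contractions[OF assms(1)] assms(2,3), of "\<lambda>i. cinner x (u i)"] assms
  by (simp add: cinner.diff_left orthonormal_def)

text \<open>
  The residual is orthogonal to the projection that was subtracted, so Pythagoras applies.
\<close>

lemma norm_residual_le:
  assumes "orthonormal u S" "finite S"
  shows "norm (x - (\<Sum>i\<in>S. cinner x (u i) *\<^sub>C u i)) \<le> norm x"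
proof -
  define y where "y = (\<Sum>i\<in>S. cinner x (u i) *\<^sub>C u i)"
  have "cinner (x - y) y = 0"
    unfolding y_def cinner.sum_right[of _ _ S]
    by (intro sum.neutral) (simp add: cinner_scaleC_right orthogonal_residual[OF assms])
  from norm_add_orthogonal[OF this] have "(norm (x - y))\<^sup>2 \<le> (norm x)\<^sup>2" by simp
  then show ?thesis unfolding y_def by (rule power2_le_imp_le) simp
qed

lemma summable_orthogonal:
  fixes u :: "nat \<Rightarrow> 'a::complex_hilbert"
  assumes u: "orthogonal_contractions u UNIV" and c: "summable (\<lambda>n. (cmod (c n))\<^sup>2)"
  shows "summable (\<lambda>n. c n *\<^sub>C u n)"
  unfolding summable_Cauchy
proof (intro allI impI)
  fix e :: real assume e: "e > 0"
  then obtain N where N: "\<And>m n. m \<ge> N \<Longrightarrow> norm (\<Sum>k=m..<n. (cmod (c k))\<^sup>2) < e\<^sup>2"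
    using c unfolding summable_Cauchy by (metis zero_less_power)
  have "norm (\<Sum>k=m..<n. c k *\<^sub>C u k) < e" if "m \<ge> N" for m n
  proof -
    have "(norm (\<Sum>k=m..<n. c k *\<^sub>C u k))\<^sup>2 \<le> (\<Sum>k=m..<n. (cmod (c k))\<^sup>2)"
      using u by (intro norm_sum_orthogonal_le) (auto intro: orthogonal_contractions_subset)
    also have "\<dots> < e\<^sup>2" using N[OF that, of n] by simp
    finally show ?thesis using e by (simp add: power2_less_imp_less)
  qed
  then show "\<exists>N. \<forall>m\<ge>N. \<forall>n. norm (\<Sum>k=m..<n. c k *\<^sub>C u k) < e" by blast
qed

lemma norm_suminf_orthogonal_le:
  fixes u :: "nat \<Rightarrow> 'a::complex_hilbert"
  assumes u: "orthogonal_contractions u UNIV" and c: "summable (\<lambda>n. (cmod (c n))\<^sup>2)"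
  shows "(norm (\<Sum>n. c n *\<^sub>C u n))\<^sup>2 \<le> (\<Sum>n. (cmod (c n))\<^sup>2)"
proof (rule LIMSEQ_le)
  show "(\<lambda>N. (norm (\<Sum>n<N. c n *\<^sub>C u n))\<^sup>2) \<longlonglongrightarrow> (norm (\<Sum>n. c n *\<^sub>C u n))\<^sup>2"
    by (intro tendsto_intros summable_LIMSEQ summable_orthogonal assms)
  show "(\<lambda>N. \<Sum>n<N. (cmod (c n))\<^sup>2) \<longlonglongrightarrow> (\<Sum>n. (cmod (c n))\<^sup>2)"
    using c by (rule summable_LIMSEQ)
  show "\<exists>N. \<forall>n\<ge>N. (norm (\<Sum>n<n. c n *\<^sub>C u n))\<^sup>2 \<le> (\<Sum>n<n. (cmod (c n))\<^sup>2)"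
    using u by (auto intro!: norm_sum_orthogonal_le intro: orthogonal_contractions_subset)
qed

lemma Bessel:
  fixes u :: "nat \<Rightarrow> 'a::complex_hilbert"
  assumes u: "orthogonal_contractions u UNIV"
  shows "summable (\<lambda>n. (cmod (cinner x (u n)))\<^sup>2)"
    and "(\<Sum>n. (cmod (cinner x (u n)))\<^sup>2) \<le> (norm x)\<^sup>2"
proof -
  have le: "(\<Sum>n<N. (cmod (cinner x (u n)))\<^sup>2) \<le> (norm x)\<^sup>2" for N
    using u by (intro Bessel_finite) (auto intro: orthogonal_contractions_subset)
  show s: "summable (\<lambda>n. (cmod (cinner x (u n)))\<^sup>2)"
    by (rule summableI_nonneg_bounded[of _ "(norm x)\<^sup>2"]) (use le in auto)
  show "(\<Sum>n. (cmod (cinner x (u n)))\<^sup>2) \<le> (norm x)\<^sup>2"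
    using le by (intro suminf_le_const s)
qed

section \<open>Bounded operators and Schmidt series\<close>

text \<open>
  The operator \<open>\<Sum> a\<^sub>n \<langle>\<cdot>, u\<^sub>n\<rangle> v\<^sub>n\<close>. Compact operators, diagonal operators, partial
  isometries between orthogonal families, and shifts of a basis all have this form, so one
  calculus serves for all of them. For an orthonormal basis \<open>e\<close>, the diagonal operator with
  entries \<open>a\<close> is \<open>schmidt_op a e e\<close>.
\<close>

definition schmidt_op ::
    "(nat \<Rightarrow> real) \<Rightarrow> (nat \<Rightarrow> 'a::complex_hilbert) \<Rightarrow> (nat \<Rightarrow> 'a) \<Rightarrow> 'a \<Rightarrow> 'a" where
  "schmidt_op a u v x = (\<Sum>n. (complex_of_real (a n) * cinner x (u n)) *\<^sub>C v n)"

lemma bounded_operatorsI: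
  assumes "\<And>x y. X (x + y) = X x + X y" "\<And>c x. X (c *\<^sub>C x) = c *\<^sub>C X x"
    "\<And>x. norm (X x) \<le> K * norm (x::'a::complex_hilbert)"
  shows "X \<in> bounded_operators"
  unfolding bounded_operators_def using assms
  by (auto intro!: bounded_linear_intro[of _ K] simp: scaleR_scaleC mult.commute)

lemma bounded_operators_linear:
  assumes "X \<in> bounded_operators"
  shows "bounded_linear X" "X (c *\<^sub>C x) = c *\<^sub>C X x"
  using assms by (auto simp: bounded_operators_def)

lemma bounded_operators_bound:
  assumes "X \<in> bounded_operators"
  obtains K where "K > 0" "\<And>x. norm (X x) \<le> K * norm x"
  using bounded_linear.pos_bounded[OF bounded_operators_linear(1)[OF assms]]
  by (auto simp: mult.commute)

lemma bounded_operators_compose: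
  "A \<in> bounded_operators \<Longrightarrow> B \<in> bounded_operators \<Longrightarrow> A \<circ> B \<in> bounded_operators"
  by (auto simp: bounded_operators_def o_def intro: bounded_linear_compose)

lemma bounded_operators_add:
  "A \<in> bounded_operators \<Longrightarrow> B \<in> bounded_operators \<Longrightarrow> (\<lambda>x. A x + B x) \<in> bounded_operators"
  by (auto simp: bounded_operators_def scaleC_add_right intro: bounded_linear_add)

lemma bounded_operators_id: "(\<lambda>x. x) \<in> bounded_operators"
  by (auto simp: bounded_operators_def)

lemma schmidt_op_eq_0: "(\<And>n. cinner x (u n) = 0) \<Longrightarrow> schmidt_op a u v x = 0"
  by (simp add: schmidt_op_def)

context
  fixes a :: "nat \<Rightarrow> real" and u v :: "nat \<Rightarrow> 'a::complex_hilbert"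
  assumes a: "bounded (range a)"
    and u: "orthogonal_contractions u UNIV" and v: "orthogonal_contractions v UNIV"
begin

lemma schmidt_coeff_le:
  assumes "\<And>n. \<bar>a n\<bar> \<le> K"
  shows "(cmod (complex_of_real (a n) * cinner x (u n)))\<^sup>2 \<le> K\<^sup>2 * (cmod (cinner x (u n)))\<^sup>2"
  unfolding norm_mult power_mult_distrib
  using assms[of n] by (intro mult_right_mono power_mono) simp_all

lemma summable_schmidt_coeff:
  "summable (\<lambda>n. (cmod (complex_of_real (a n) * cinner x (u n)))\<^sup>2)"
proof -
  obtain K where "\<And>n. \<bar>a n\<bar> \<le> K" using a by (auto simp: bounded_iff)
  from schmidt_coeff_le[OF this]
  have "norm ((cmod (complex_of_real (a n) * cinner x (u n)))\<^sup>2) \<le> K\<^sup>2 * (cmod (cinner x (u n)))\<^sup>2" for n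
    by (simp only: real_norm_def abs_of_nonneg zero_le_power2)
  then show ?thesis
    by (intro summable_comparison_test'[OF summable_mult[OF Bessel(1)[OF u]]])
qed

lemma summable_schmidt:
  "summable (\<lambda>n. (complex_of_real (a n) * cinner x (u n)) *\<^sub>C v n)"
  using v summable_schmidt_coeff by (rule summable_orthogonal)

lemma norm_schmidt_op_le:
  assumes K: "\<And>n. \<bar>a n\<bar> \<le> K"
  shows "norm (schmidt_op a u v x) \<le> K * norm x"
proof -
  have "K \<ge> 0" using K[of 0] by linarith
  have "(norm (schmidt_op a u v x))\<^sup>2 \<le> (\<Sum>n. (cmod (complex_of_real (a n) * cinner x (u n)))\<^sup>2)"
    unfolding schmidt_op_def by (rule norm_suminf_orthogonal_le[OF v summable_schmidt_coeff])
  also have "\<dots> \<le> (\<Sum>n. K\<^sup>2 * (cmod (cinner x (u n)))\<^sup>2)"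
    by (intro suminf_le schmidt_coeff_le K summable_schmidt_coeff summable_mult Bessel(1)[OF u])
  also have "\<dots> \<le> K\<^sup>2 * (norm x)\<^sup>2"
    using Bessel[OF u, of x] by (simp add: suminf_mult mult_left_mono)
  finally have "(norm (schmidt_op a u v x))\<^sup>2 \<le> (K * norm x)\<^sup>2" by (simp add: power_mult_distrib)
  then show ?thesis by (rule power2_le_imp_le) (use \<open>K \<ge> 0\<close> in simp)
qed

lemma schmidt_op_bounded: "schmidt_op a u v \<in> bounded_operators"
proof -
  obtain K where K: "\<And>n. \<bar>a n\<bar> \<le> K" using a by (auto simp: bounded_iff)
  show ?thesis
  proof (rule bounded_operatorsI)
    show "schmidt_op a u v (x + y) = schmidt_op a u v x + schmidt_op a u v y" for x y
      unfolding schmidt_op_def by (subst suminf_add[OF summable_schmidt summable_schmidt])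
        (simp add: cinner_add_left scaleC_add_left distrib_left)
    show "schmidt_op a u v (c *\<^sub>C x) = c *\<^sub>C schmidt_op a u v x" for c x
      unfolding schmidt_op_def
      by (subst bounded_linear.suminf[OF scaleC.bounded_linear_right summable_schmidt])
        (simp add: cinner_scaleC_left scaleC_scaleC mult_ac)
    show "norm (schmidt_op a u v x) \<le> K * norm x" for x by (rule norm_schmidt_op_le[OF K])
  qed
qed

lemma cinner_schmidt_op_sums:
  "(\<lambda>n. complex_of_real (a n) * cinner x (u n) * cinner (v n) y) sums cinner (schmidt_op a u v x) y"
  using bounded_linear.sums[OF cinner.bounded_linear_left summable_sums[OF summable_schmidt]]
  by (simp add: schmidt_op_def cinner_scaleC_left)

text \<open>
  The coordinates of the value of a Schmidt series along \<open>v\<close>. The factor \<open>\<parallel>v\<^sub>k\<parallel>\<^sup>2\<close> makes the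
  formula correct for zero vectors.
\<close>

lemma cinner_schmidt_op_range:
  "cinner (schmidt_op a u v x) (v k) = complex_of_real (a k * (norm (v k))\<^sup>2) * cinner x (u k)"
proof -
  have "(\<lambda>n. complex_of_real (a n) * cinner x (u n) * cinner (v n) (v k)) sums
      (complex_of_real (a k) * cinner x (u k) * cinner (v k) (v k))"
    using v sums_finite[of "{k}" "\<lambda>n. complex_of_real (a n) * cinner x (u n) * cinner (v n) (v k)"]
    by (auto simp: orthogonal_contractions_def)
  from sums_unique2[OF cinner_schmidt_op_sums this] show ?thesis
    by (simp add: cinner_self mult_ac)
qed

lemma schmidt_op_basis: "schmidt_op a u v (u k) = complex_of_real (a k * (norm (u k))\<^sup>2) *\<^sub>C v k"
proof -
  have "schmidt_op a u v (u k) = (\<Sum>n\<in>{k}. (complex_of_real (a n) * cinner (u k) (u n)) *\<^sub>C v n)"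
    unfolding schmidt_op_def using u by (intro suminf_finite) (auto simp: orthogonal_contractions_def)
  then show ?thesis by (simp add: cinner_self)
qed

end

lemma schmidt_op_adjoint:
  assumes a: "bounded (range a)" and u: "orthogonal_contractions u UNIV"
    and v: "orthogonal_contractions v UNIV"
  shows "cinner (schmidt_op a u v x) y = cinner x (schmidt_op a v u y)"
proof -
  have "(\<lambda>n. cnj (complex_of_real (a n) * cinner y (v n) * cinner (u n) x))
      sums cnj (cinner (schmidt_op a v u y) x)"
    using cinner_schmidt_op_sums[OF a v u, of y x] by (simp only: sums_cnj)
  moreover have "cnj (complex_of_real (a n) * cinner y (v n) * cinner (u n) x) =
      complex_of_real (a n) * cinner x (u n) * cinner (v n) y" for n
    using cinner_commute[of "v n" y] cinner_commute[of x "u n"] by simp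
  ultimately have "(\<lambda>n. complex_of_real (a n) * cinner x (u n) * cinner (v n) y)
      sums cnj (cinner (schmidt_op a v u y) x)" by (simp only:)
  from sums_unique2[OF cinner_schmidt_op_sums[OF a u v] this] show ?thesis
    using cinner_commute by metis
qed

text \<open>
  Schmidt series whose inner families match compose by multiplying the coefficients. This is
  the multiplication table behind every factorisation below.
\<close>

lemma schmidt_op_compose:
  assumes a: "bounded (range a)" and b: "bounded (range b)"
    and u: "orthogonal_contractions u UNIV" and v: "orthogonal_contractions v UNIV"
  shows "schmidt_op b v w \<circ> schmidt_op a u v = schmidt_op (\<lambda>n. b n * a n * (norm (v n))\<^sup>2) u w"
  by (rule ext) (simp add: schmidt_op_def[of _ v w] schmidt_op_def[of _ u w]
      cinner_schmidt_op_range[OF a u v] mult_ac)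

section \<open>Orthonormal bases\<close>

text \<open>
  Orthogonality to a finite set is used throughout as a condition of finite codimension.
  Passing to an orthonormal set with a smaller orthogonal complement makes projections
  available.
\<close>

lemma Gram_Schmidt:
  fixes F :: "'a::complex_hilbert set"
  assumes "finite F"
  shows "\<exists>G. finite G \<and> orthonormal (\<lambda>x. x) G \<and>
    (\<forall>x. (\<forall>g\<in>G. cinner x g = 0) \<longrightarrow> (\<forall>f\<in>F. cinner x f = 0))"
  using assms
proof (induction F)
  case empty
  then show ?case by (intro exI[of _ "{}"]) (auto simp: orthonormal_def)
next
  case (insert f F)
  then obtain G where G: "finite G" "orthonormal (\<lambda>x. x) G"
    "\<And>x f. (\<forall>g\<in>G. cinner x g = 0) \<Longrightarrow> f \<in> F \<Longrightarrow> cinner x f = 0" by blast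
  define p where "p = (\<Sum>g\<in>G. cinner f g *\<^sub>C g)"
  define r where "r = f - p"
  have r: "cinner r g = 0" if "g \<in> G" for g
    unfolding r_def p_def using orthogonal_residual[OF G(2,1) that] by simp
  have f: "cinner x f = cinner x r" if "\<forall>g\<in>G. cinner x g = 0" for x
  proof -
    have "cinner x p = 0"
      unfolding p_def cinner.sum_right using that by (simp add: cinner_scaleC_right)
    then show ?thesis by (simp add: r_def cinner.diff_right)
  qed
  show ?case
  proof (cases "r = 0")
    case True
    then show ?thesis using G f by (intro exI[of _ G]) auto
  next
    case False
    define e where "e = complex_of_real (1 / norm r) *\<^sub>C r"
    have r_e: "r = complex_of_real (norm r) *\<^sub>C e" and "norm e = 1"
      using False by (auto simp: e_def scaleC_scaleC norm_scaleC norm_divide scaleC_one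
          simp flip: of_real_mult)
    moreover have e: "cinner e g = 0" "cinner g e = 0" if "g \<in> G" for g
      using r[OF that] cinner_eq_0_commute[of g r]
      by (auto simp: e_def cinner_scaleC_left cinner_scaleC_right)
    ultimately have "orthonormal (\<lambda>x. x) (insert e G)" using G(2) by (auto simp: orthonormal_def)
    moreover have "cinner x r = 0" if "cinner x e = 0" for x
      using that by (subst r_e) (simp add: cinner_scaleC_right)
    ultimately show ?thesis using G f by (intro exI[of _ "insert e G"]) auto
  qed
qed

text \<open>
  A finite orthonormal set does not span the space; the residual of a vector outside the
  span, normalised, is the required one.
\<close>

lemma ex_unit_orthogonal:
  fixes F :: "'a::complex_hilbert set"
  assumes inf: "infinite_dimensional TYPE('a)" and "finite F"
  shows "\<exists>x. norm x = 1 \<and> (\<forall>f\<in>F. cinner x f = 0)"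
proof -
  obtain G where G: "finite G" "orthonormal (\<lambda>x::'a. x) G"
    "\<And>x. \<forall>g\<in>G. cinner x g = 0 \<Longrightarrow> \<forall>f\<in>F. cinner x f = 0"
    using Gram_Schmidt[OF assms(2)] by blast
  have "complex_vector.span G \<noteq> UNIV"
    using inf G(1) unfolding infinite_dimensional_def by blast
  then obtain y where y: "y \<notin> complex_vector.span G" by blast
  define r where "r = y - (\<Sum>g\<in>G. cinner y g *\<^sub>C g)"
  have "(\<Sum>g\<in>G. cinner y g *\<^sub>C g) \<in> complex_vector.span G"
    by (intro complex_vector.span_sum complex_vector.span_scale complex_vector.span_base)
  with y have "r \<noteq> 0" unfolding r_def by auto
  moreover have "\<forall>g\<in>G. cinner r g = 0"
    unfolding r_def using orthogonal_residual[OF G(2,1)] by simp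
  ultimately show ?thesis using G(3)[of r]
    by (intro exI[of _ "complex_of_real (1 / norm r) *\<^sub>C r"])
      (auto simp: norm_scaleC cinner_scaleC_left norm_divide)
qed

definition orthonormal_basis :: "(nat \<Rightarrow> 'a::complex_hilbert) \<Rightarrow> bool" where
  "orthonormal_basis e \<longleftrightarrow> orthonormal e UNIV \<and> (\<forall>x. (\<forall>n. cinner x (e n) = 0) \<longrightarrow> x = 0)"

lemma orthonormal_dist:
  assumes "orthonormal u S" "i \<in> S" "j \<in> S" "i \<noteq> j"
  shows "(dist (u i) (u j))\<^sup>2 = 2"
proof -
  have "cinner (u i) (- u j) = 0" using assms by (simp add: orthonormal_def cinner.minus_right)
  from norm_add_orthogonal[OF this] show ?thesis using assms by (simp add: orthonormal_def dist_norm)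
qed

text \<open>
  A maximal orthonormal set is total. Separability makes it countable, since distinct
  members are at distance \<open>\<surd>2\<close> and hence cannot be within \<open>1/2\<close> of the same point of a dense
  set; infinite dimension makes it infinite.
\<close>

lemma ex_orthonormal_basis:
  assumes inf: "infinite_dimensional TYPE('a::complex_hilbert)" and sep: "separable TYPE('a)"
  shows "\<exists>e :: nat \<Rightarrow> 'a. orthonormal_basis e"
proof -
  define \<O> where "\<O> = {S. orthonormal (\<lambda>x::'a. x) S}"
  have "\<exists>M\<in>\<O>. \<forall>S\<in>\<O>. M \<subseteq> S \<longrightarrow> S = M"
  proof (rule subset_Zorn')
    fix \<C> assume \<C>: "subset.chain \<O> \<C>"
    show "\<Union>\<C> \<in> \<O>"
      unfolding \<O>_def orthonormal_def mem_Collect_eq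
    proof (intro conjI ballI impI)
      show "norm x = 1" if "x \<in> \<Union>\<C>" for x
        using that \<C> by (auto simp: subset_chain_def \<O>_def orthonormal_def)
      show "cinner x y = 0" if xy: "x \<in> \<Union>\<C>" "y \<in> \<Union>\<C>" "x \<noteq> y" for x y
      proof -
        obtain S T where "S \<in> \<C>" "T \<in> \<C>" "x \<in> S" "y \<in> T" using xy by blast
        moreover have "S \<subseteq> T \<or> T \<subseteq> S" using \<C> calculation by (auto simp: subset_chain_def)
        ultimately obtain R where "R \<in> \<C>" "x \<in> R" "y \<in> R" by blast
        then show ?thesis using \<C> xy(3) by (auto simp: subset_chain_def \<O>_def orthonormal_def)
      qed
    qed
  qed
  then obtain M where M: "orthonormal (\<lambda>x::'a. x) M"
    and max: "\<And>S. orthonormal (\<lambda>x::'a. x) S \<Longrightarrow> M \<subseteq> S \<Longrightarrow> S = M" by (auto simp: \<O>_def)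
  have total: "x = 0" if x: "\<And>m. m \<in> M \<Longrightarrow> cinner x m = 0" for x
  proof (rule ccontr)
    assume "x \<noteq> 0"
    define y where "y = complex_of_real (1 / norm x) *\<^sub>C x"
    have "norm y = 1" using \<open>x \<noteq> 0\<close> by (simp add: y_def norm_scaleC norm_divide)
    moreover have y: "cinner y m = 0" "cinner m y = 0" if "m \<in> M" for m
      using x[OF that] cinner_eq_0_commute[of m x]
      by (auto simp: y_def cinner_scaleC_left cinner_scaleC_right)
    ultimately have "orthonormal (\<lambda>x. x) (insert y M)" using M by (auto simp: orthonormal_def)
    from max[OF this] have "y \<in> M" by auto
    from y(1)[OF this] \<open>norm y = 1\<close> show False by (simp add: cinner_self)
  qed
  have "infinite M"
    using ex_unit_orthogonal[OF inf, of M] total by fastforce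
  moreover have "countable M"
  proof -
    obtain D :: "'a set" where D: "countable D" "closure D = UNIV"
      using sep by (auto simp: separable_def)
    have "\<exists>d\<in>D. dist d m < 1/2" for m
    proof -
      have "\<forall>\<epsilon>>0. \<exists>y\<in>D. dist y m < \<epsilon>" using D(2) closure_approachable[of m D] by auto
      from this[rule_format, of "1/2"] show ?thesis by simp
    qed
    then obtain d where d: "\<And>m. d m \<in> D" "\<And>m. dist (d m) m < 1/2" by metis
    have "inj_on d M"
    proof (rule inj_onI, rule ccontr)
      fix x y assume xy: "x \<in> M" "y \<in> M" "d x = d y" "x \<noteq> y"
      have "dist x y < 1" using d(2)[of x] d(2)[of y] xy(3) dist_triangle_half_r by metis
      then have "(dist x y)\<^sup>2 < 1" by (simp add: power_less_one_iff)
      with orthonormal_dist[OF M xy(1,2,4)] show False by simp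
    qed
    moreover have "countable (d ` M)" using d(1) D(1) by (metis countable_subset image_subsetI)
    ultimately show ?thesis using countable_image_inj_on by blast
  qed
  ultimately obtain e where e: "bij_betw e (UNIV :: nat set) M"
    using countableE_infinite bij_betw_inv_into by metis
  then have inj: "inj e" and rng: "range e = M" by (auto simp: bij_betw_def)
  have "orthonormal_basis e"
    unfolding orthonormal_basis_def
  proof (intro conjI allI impI)
    show "orthonormal e UNIV"
      using M unfolding orthonormal_def rng[symmetric] by (auto simp: inj_eq[OF inj])
    show "x = 0" if "\<forall>n. cinner x (e n) = 0" for x
      using that rng by (intro total) auto
  qed
  then show ?thesis by blast
qed

lemma orthonormal_basis_contractions: "orthonormal_basis e \<Longrightarrow> orthogonal_contractions e UNIV"
  by (simp add: orthonormal_basis_def orthonormal_imp_contractions)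

lemma orthonormal_basis_expansion:
  assumes e: "orthonormal_basis e"
  shows "(\<lambda>n. cinner x (e n) *\<^sub>C e n) sums x"
proof -
  note ec = orthonormal_basis_contractions[OF e]
  define y where "y = schmidt_op (\<lambda>_. 1) e e x"
  have "cinner y (e k) = cinner x (e k)" for k
    unfolding y_def using cinner_schmidt_op_range[OF _ ec ec, of "\<lambda>_. 1" x k] e
    by (simp add: orthonormal_basis_def orthonormal_def)
  then have "y - x = 0"
    using e unfolding orthonormal_basis_def by (metis cinner.diff_left right_minus_eq)
  then show ?thesis
    using summable_sums[OF summable_schmidt[OF _ ec ec, of "\<lambda>_. 1" x]] by (simp add: y_def schmidt_op_def)
qed

text \<open>
  Identities between bounded operators can be checked on an orthonormal basis, which reduces
  those below to bookkeeping with indices.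
\<close>

lemma bounded_operators_eqI:
  assumes e: "orthonormal_basis e" and X: "X \<in> bounded_operators" and Y: "Y \<in> bounded_operators"
    and XY: "\<And>n. X (e n) = Y (e n)"
  shows "X = Y"
proof
  fix x
  have "(\<lambda>n. cinner x (e n) *\<^sub>C Z (e n)) sums Z x" if "Z \<in> bounded_operators" for Z
    using bounded_linear.sums[OF bounded_operators_linear(1)[OF that] orthonormal_basis_expansion[OF e, of x]]
    by (simp add: bounded_operators_linear(2)[OF that])
  from this[OF X] this[OF Y] XY show "X x = Y x" by (simp add: sums_unique2)
qed

text \<open>
  The vector \<open>X\<^sup>* y\<close>, built from its coordinates \<open>\<langle>y, X e\<^sub>n\<rangle>\<close>. They are square summable: for
  a partial sum \<open>z\<close> of the series one has \<open>\<parallel>z\<parallel>\<^sup>2 = \<langle>y, X z\<rangle> \<le> \<parallel>y\<parallel> K \<parallel>z\<parallel>\<close>, whence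
  \<open>\<parallel>z\<parallel> \<le> K \<parallel>y\<parallel>\<close>.
\<close>

lemma ex_adjoint_vector:
  fixes X :: "'a::complex_hilbert \<Rightarrow> 'a" and e :: "nat \<Rightarrow> 'a"
  assumes e: "orthonormal_basis e" and X: "X \<in> bounded_operators"
  shows "\<exists>z. \<forall>x. cinner (X x) y = cinner x z"
proof -
  note ec = orthonormal_basis_contractions[OF e]
  interpret X: bounded_linear X by (rule bounded_operators_linear(1)[OF X])
  obtain K where K: "K > 0" "\<And>x. norm (X x) \<le> K * norm x" by (rule bounded_operators_bound[OF X]) auto
  define c where "c n = cinner y (X (e n))" for n
  have bound: "(\<Sum>n<N. (cmod (c n))\<^sup>2) \<le> (K * norm y)\<^sup>2" for N
  proof -
    define z where "z = (\<Sum>n<N. c n *\<^sub>C e n)"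
    have z: "(norm z)\<^sup>2 = (\<Sum>n<N. (cmod (c n))\<^sup>2)"
      unfolding z_def using norm_sum_orthogonal[of e "{..<N}" c] ec e
      by (auto simp: orthonormal_basis_def orthonormal_def intro: orthogonal_contractions_subset)
    have "cinner y (X z) = complex_of_real ((norm z)\<^sup>2)"
      unfolding z unfolding z_def
      by (simp add: X.sum bounded_operators_linear(2)[OF X] cinner.sum_right cinner_scaleC_right
          complex_norm_square c_def mult.commute del: of_real_power)
    then have "(norm z)\<^sup>2 = cmod (cinner y (X z))" by (simp add: norm_power)
    also have "\<dots> \<le> norm y * norm (X z)" by (rule cinner_Cauchy_Schwarz)
    also have "\<dots> \<le> norm y * (K * norm z)" by (intro mult_left_mono K(2)) simp
    finally have "norm z * norm z \<le> (K * norm y) * norm z" by (simp add: power2_eq_square mult_ac)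
    then have "norm z \<le> K * norm y" by (cases "z = 0") (use K in auto)
    then show ?thesis unfolding z[symmetric] by (rule power_mono) simp
  qed
  have "summable (\<lambda>n. (cmod (c n))\<^sup>2)"
    by (rule summableI_nonneg_bounded[of _ "(K * norm y)\<^sup>2"]) (use bound in auto)
  then have sum: "summable (\<lambda>n. c n *\<^sub>C e n)" by (rule summable_orthogonal[OF ec])
  define z where "z = (\<Sum>n. c n *\<^sub>C e n)"
  have "cinner (X x) y = cinner x z" for x
  proof -
    have "(\<lambda>n. cnj (c n) * cinner x (e n)) sums cinner x z"
      using bounded_linear.sums[OF cinner.bounded_linear_right[of x] summable_sums[OF sum]]
      by (simp add: z_def cinner_scaleC_right)
    moreover have "(\<lambda>n. cinner x (e n) * cinner (X (e n)) y) sums cinner (X x) y"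
      using bounded_linear.sums[OF bounded_linear_compose[OF cinner.bounded_linear_left[of y] X.bounded_linear_axioms]
          orthonormal_basis_expansion[OF e, of x]]
      by (simp add: bounded_operators_linear(2)[OF X] cinner_scaleC_left)
    moreover have "cnj (c n) = cinner (X (e n)) y" for n
      unfolding c_def by (metis cinner_commute)
    ultimately show ?thesis by (simp add: sums_unique2 mult.commute)
  qed
  then show ?thesis by blast
qed

section \<open>Operators in a proper ideal are compact\<close>

lemma bounded_operators_zero: "X \<in> bounded_operators \<Longrightarrow> X 0 = (0::'a::complex_hilbert)"
  using bounded_operators_linear(1) linear_simps(3) by blast

lemma identity_notin_ideal:
  assumes "operator_ideal I" shows "(\<lambda>x. x) \<notin> I"
proof
  assume "(\<lambda>x. x) \<in> I"
  then have "Y \<circ> (\<lambda>x. x) \<in> I" if "Y \<in> bounded_operators" for Y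
    using assms that unfolding operator_ideal_def by blast
  then have "bounded_operators \<subseteq> I" by (auto simp: o_def)
  with assms show False by (auto simp: operator_ideal_def)
qed

text \<open>
  Operators in a proper ideal are compact; this is the form of compactness that the ideal
  property yields directly. If it failed for some \<open>\<epsilon>\<close>, one could choose orthonormal \<open>u\<^sub>n\<close>
  one after the other, each orthogonal to all earlier \<open>u\<^sub>j\<close> and \<open>X\<^sup>* X u\<^sub>j\<close>, with
  \<open>\<parallel>X u\<^sub>n\<parallel> > \<epsilon>\<close>. Then the \<open>X u\<^sub>n\<close> are orthogonal and bounded below in norm, so \<open>X\<close> can be
  inverted on their closed span: \<open>A X B\<close> is the identity for bounded \<open>A\<close> and \<open>B\<close>, and the
  ideal is everything.
\<close>

lemma ideal_small_off_finite:
  fixes X :: "'a::complex_hilbert \<Rightarrow> 'a" and e :: "nat \<Rightarrow> 'a"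
  assumes e: "orthonormal_basis e" and I: "operator_ideal I" and XI: "X \<in> I" and \<epsilon>: "\<epsilon> > 0"
  shows "\<exists>F. finite F \<and> (\<forall>x. (\<forall>f\<in>F. cinner x f = 0) \<longrightarrow> norm (X x) \<le> \<epsilon> * norm x)"
proof (rule ccontr)
  assume contra: "\<not> ?thesis"
  have X: "X \<in> bounded_operators" using I XI by (auto simp: operator_ideal_def)
  have big: "\<exists>x. norm x = 1 \<and> norm (X x) > \<epsilon> \<and> (\<forall>f\<in>F. cinner x f = 0)" if "finite F" for F
  proof -
    obtain x where x: "\<forall>f\<in>F. cinner x f = 0" "norm (X x) > \<epsilon> * norm x"
      using contra \<open>finite F\<close> by (meson not_le)
    then have "x \<noteq> 0" using bounded_operators_zero[OF X] by auto
    then show ?thesis using x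
      by (intro exI[of _ "complex_of_real (1 / norm x) *\<^sub>C x"])
        (auto simp: norm_scaleC cinner_scaleC_left norm_divide bounded_operators_linear(2)[OF X] field_simps)
  qed
  obtain z where z: "\<And>x y. cinner (X x) y = cinner x (z y)"
    using ex_adjoint_vector[OF e X] by metis
  have "\<exists>u :: nat \<Rightarrow> 'a. \<forall>n. norm (u n) = 1 \<and> norm (X (u n)) > \<epsilon> \<and>
      (\<forall>f \<in> u ` {..<n} \<union> (\<lambda>j. z (X (u j))) ` {..<n}. cinner (u n) f = 0)"
  proof (rule dependent_wellorder_choice[where P="\<lambda>u n x. norm x = 1 \<and> norm (X x) > \<epsilon> \<and>
      (\<forall>f \<in> u ` {..<n} \<union> (\<lambda>j. z (X (u j))) ` {..<n}. cinner x f = 0)"])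
    fix r :: 'a and f g :: "nat \<Rightarrow> 'a" and n :: nat
    assume fg: "\<And>j. j < n \<Longrightarrow> f j = g j"
    have "f ` {..<n} = g ` {..<n}" "(\<lambda>j. z (X (f j))) ` {..<n} = (\<lambda>j. z (X (g j))) ` {..<n}"
      using fg by (auto intro!: image_cong)
    then show "(norm r = 1 \<and> norm (X r) > \<epsilon> \<and>
        (\<forall>y \<in> f ` {..<n} \<union> (\<lambda>j. z (X (f j))) ` {..<n}. cinner r y = 0)) =
      (norm r = 1 \<and> norm (X r) > \<epsilon> \<and>
        (\<forall>y \<in> g ` {..<n} \<union> (\<lambda>j. z (X (g j))) ` {..<n}. cinner r y = 0))" by simp
  qed (rule big, simp)
  then obtain u :: "nat \<Rightarrow> 'a" where *: "\<And>n. norm (u n) = 1 \<and> norm (X (u n)) > \<epsilon> \<and>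
      (\<forall>f \<in> u ` {..<n} \<union> (\<lambda>j. z (X (u j))) ` {..<n}. cinner (u n) f = 0)" by blast
  have u: "norm (u n) = 1" "norm (X (u n)) > \<epsilon>" for n using *[of n] by blast+
  have perp: "cinner (u n) (u j) = 0" if "j < n" for n j using *[of n] that by blast
  have perpX: "cinner (X (u n)) (X (u j)) = 0" if "j < n" for n j
    unfolding z using *[of n] that by blast
  \<comment> \<open>The image vectors, normalised; \<open>A\<close> and \<open>B\<close> below exchange them and the \<open>u\<^sub>n\<close> with the basis.\<close>
  define v where "v n = complex_of_real (1 / norm (X (u n))) *\<^sub>C X (u n)" for n
  have pos: "norm (X (u n)) > 0" for n using u(2)[of n] \<epsilon> by linarith
  have u_on: "orthonormal u UNIV"
    using u(1) perp cinner_eq_0_commute unfolding orthonormal_def by (metis nat_neq_iff)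
  have "cinner (X (u i)) (X (u j)) = 0" if "i \<noteq> j" for i j
    using perpX that cinner_eq_0_commute by (metis nat_neq_iff)
  then have v_on: "orthonormal v UNIV"
    using pos by (auto simp: orthonormal_def v_def norm_scaleC norm_divide cinner_scaleC_left cinner_scaleC_right)
  have uc: "orthogonal_contractions u UNIV" and vc: "orthogonal_contractions v UNIV"
    and ec: "orthogonal_contractions e UNIV"
    using u_on v_on orthonormal_basis_contractions[OF e] orthonormal_imp_contractions by auto
  define B where "B = schmidt_op (\<lambda>_. 1) e u"
  define A where "A = schmidt_op (\<lambda>n. 1 / norm (X (u n))) v e"
  have "\<bar>1 / norm (X (u n))\<bar> \<le> 1 / \<epsilon>" for n
    using u(2)[of n] \<epsilon> pos[of n] by (simp add: frac_le)
  then have bound: "bounded (range (\<lambda>n. 1 / norm (X (u n))))" by (auto simp: bounded_iff)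
  have A: "A \<in> bounded_operators" unfolding A_def by (rule schmidt_op_bounded[OF bound vc ec])
  have B: "B \<in> bounded_operators" unfolding B_def by (rule schmidt_op_bounded[OF _ ec uc]) simp
  have AXB: "(A \<circ> (X \<circ> B)) (e n) = e n" for n
  proof -
    have "B (e n) = u n"
      unfolding B_def using schmidt_op_basis[OF _ ec uc, of "\<lambda>_. 1" n] e
      by (simp add: orthonormal_basis_def orthonormal_def scaleC_one)
    moreover have "X (u n) = complex_of_real (norm (X (u n))) *\<^sub>C v n"
      using pos[of n] by (simp add: v_def scaleC_scaleC scaleC_one flip: of_real_mult)
    moreover have "A (v n) = complex_of_real (1 / norm (X (u n))) *\<^sub>C e n"
      unfolding A_def using schmidt_op_basis[OF bound vc ec, of n] v_on
      by (simp add: orthonormal_def)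
    ultimately have "A (X (B (e n))) = complex_of_real (norm (X (u n))) *\<^sub>C complex_of_real (1 / norm (X (u n))) *\<^sub>C e n"
      using bounded_operators_linear(2)[OF A] by metis
    then show ?thesis using pos[of n] by (simp add: scaleC_scaleC scaleC_one flip: of_real_mult)
  qed
  have "A \<circ> (X \<circ> B) = (\<lambda>x. x)"
    by (rule bounded_operators_eqI[OF e]) (auto intro: bounded_operators_compose A B X bounded_operators_id AXB[unfolded o_def] simp: AXB[unfolded o_def])
  moreover have "A \<circ> (X \<circ> B) \<in> I"
    using I XI A B unfolding operator_ideal_def by blast
  ultimately show False using identity_notin_ideal[OF I] by simp
qed

text \<open>
  If \<open>F\<close> is orthonormal, the unit ball of its span lies in this set. Adding one vector at a
  time exhibits the set as a continuous image of a product of compact sets.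
\<close>

lemma compact_finite_combinations:
  fixes F :: "'a::complex_hilbert set"
  assumes "finite F"
  shows "compact {\<Sum>f\<in>F. c f *\<^sub>C f | c. \<forall>f\<in>F. cmod (c f) \<le> 1}"
  using assms
proof (induction F)
  case (insert f F)
  let ?S = "\<lambda>F. {\<Sum>f\<in>F. c f *\<^sub>C f | c. \<forall>f\<in>F. cmod (c f) \<le> 1} :: 'a set"
  have "?S (insert f F) = (\<lambda>(c, y). c *\<^sub>C f + y) ` (cball 0 1 \<times> ?S F)" (is "?L = ?R")
  proof
    show "?L \<subseteq> ?R" using insert.hyps by (force simp: image_iff)
    show "?R \<subseteq> ?L"
    proof clarsimp
      fix a c assume "cmod a \<le> 1" "\<forall>f\<in>F. cmod (c f) \<le> 1"
      then show "\<exists>ca. a *\<^sub>C f + (\<Sum>f\<in>F. c f *\<^sub>C f) = (\<Sum>f\<in>insert f F. ca f *\<^sub>C f) \<and>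
          cmod (ca f) \<le> 1 \<and> (\<forall>f\<in>F. cmod (ca f) \<le> 1)"
        using insert.hyps by (intro exI[of _ "c(f := a)"]) (auto intro!: sum.cong)
    qed
  qed
  moreover have "compact ?R"
    by (intro compact_continuous_image compact_Times insert.IH compact_cball)
      (auto simp: case_prod_unfold intro!: continuous_intros scaleC.continuous_on)
  ultimately show ?case by simp
qed simp

text \<open>
  Up to \<open>\<epsilon>/4\<close>, the operator factors through the projection to a finite-dimensional subspace,
  where the image of the ball is compact. So the image of the ball is totally bounded.
\<close>

lemma compact_closure_image_ball:
  fixes X :: "'a::complex_hilbert \<Rightarrow> 'a" and e :: "nat \<Rightarrow> 'a"
  assumes e: "orthonormal_basis e" and I: "operator_ideal I" and XI: "X \<in> I"
  shows "compact (closure (X ` cball 0 1))"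
  unfolding compact_eq_totally_bounded
proof (intro conjI allI impI)
  have X: "X \<in> bounded_operators" using I XI by (auto simp: operator_ideal_def)
  interpret X: bounded_linear X by (rule bounded_operators_linear(1)[OF X])
  show "complete (closure (X ` cball 0 1))" by (simp add: complete_eq_closed)
  fix \<epsilon> :: real assume \<epsilon>: "\<epsilon> > 0"
  obtain F where F: "finite F" "\<And>x. (\<forall>f\<in>F. cinner x f = 0) \<Longrightarrow> norm (X x) \<le> \<epsilon> / 4 * norm x"
    using ideal_small_off_finite[OF e I XI, of "\<epsilon> / 4"] \<epsilon> by auto
  obtain G where G: "finite G" "orthonormal (\<lambda>x::'a. x) G"
    "\<And>x. \<forall>g\<in>G. cinner x g = 0 \<Longrightarrow> \<forall>f\<in>F. cinner x f = 0"
    using Gram_Schmidt[OF F(1)] by blast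
  define C where "C = {\<Sum>f\<in>G. c f *\<^sub>C f | c. \<forall>f\<in>G. cmod (c f) \<le> 1}"
  have "compact (X ` C)"
    unfolding C_def by (intro compact_continuous_image X.continuous_on continuous_on_id compact_finite_combinations G(1))
  then obtain k where k: "finite k" "X ` C \<subseteq> (\<Union>y\<in>k. ball y (\<epsilon> / 4))"
    unfolding compact_eq_totally_bounded using \<epsilon> by (meson divide_pos_pos zero_less_numeral)
  have near: "\<exists>y\<in>k. dist y (X x) < \<epsilon> / 2" if "norm x \<le> 1" for x
  proof -
    define p where "p = (\<Sum>g\<in>G. cinner x g *\<^sub>C g)"
    have "cmod (cinner x g) \<le> 1" if "g \<in> G" for g
      using cinner_Cauchy_Schwarz[of x g] that G(2) \<open>norm x \<le> 1\<close> by (simp add: orthonormal_def)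
    then have "X p \<in> X ` C" unfolding C_def p_def by blast
    then obtain y where y: "y \<in> k" "dist y (X p) < \<epsilon> / 4" using k(2) by auto
    have "norm (X (x - p)) \<le> \<epsilon> / 4 * norm (x - p)"
      using orthogonal_residual[OF G(2,1), of _ x] unfolding p_def by (intro F(2) G(3)) auto
    also have "\<dots> \<le> \<epsilon> / 4 * 1"
      using norm_residual_le[OF G(2,1), of x] \<open>norm x \<le> 1\<close> \<epsilon> unfolding p_def by (intro mult_left_mono) auto
    finally have "dist (X p) (X x) \<le> \<epsilon> / 4" by (simp add: dist_norm X.diff norm_minus_commute)
    with y show ?thesis using dist_triangle[of y "X x" "X p"] by (intro bexI[of _ y]) auto
  qed
  show "\<exists>k. finite k \<and> closure (X ` cball 0 1) \<subseteq> (\<Union>x\<in>k. ball x \<epsilon>)"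
  proof (intro exI[of _ k] conjI k(1) subsetI)
    fix w assume "w \<in> closure (X ` cball 0 1)"
    then have "\<exists>y\<in>X ` cball 0 1. dist y w < \<epsilon> / 2" using \<epsilon> by (simp only: closure_approachable)
    then obtain x where x: "norm x \<le> 1" "dist (X x) w < \<epsilon> / 2" by auto
    from near[OF x(1)] obtain y where "y \<in> k" "dist y (X x) < \<epsilon> / 2" by blast
    with x(2) show "w \<in> (\<Union>x\<in>k. ball x \<epsilon>)" using dist_triangle[of y w "X x"] by (intro UN_I[of y]) auto
  qed
qed

section \<open>The Schmidt decomposition of a compact operator\<close>

text \<open>
  A compact operator attains its norm on every subspace of the form \<open>F\<^sup>\<bottom>\<close>. Let \<open>s\<close> be its
  norm there and \<open>w\<^sub>k\<close> a maximising sequence of unit vectors along which \<open>X w\<^sub>k\<close> converges.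
  Then \<open>\<parallel>X (w\<^sub>k + w\<^sub>l)\<parallel>\<close> is close to \<open>2 s\<close>, so \<open>\<parallel>w\<^sub>k + w\<^sub>l\<parallel>\<close> is close to \<open>2\<close>, and by the
  parallelogram law \<open>\<parallel>w\<^sub>k - w\<^sub>l\<parallel>\<close> is close to \<open>0\<close>: the sequence itself converges, and its
  limit is a maximiser.
\<close>

lemma ex_norm_attained:
  fixes X :: "'a::complex_hilbert \<Rightarrow> 'a"
  assumes inf: "infinite_dimensional TYPE('a)" and X: "X \<in> bounded_operators"
    and compact: "compact (closure (X ` cball 0 1))" and F: "finite F"
  shows "\<exists>u. norm u = 1 \<and> (\<forall>f\<in>F. cinner u f = 0) \<and>
    (\<forall>x. (\<forall>f\<in>F. cinner x f = 0) \<longrightarrow> norm (X x) \<le> norm (X u) * norm x)"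
proof -
  interpret X: bounded_linear X by (rule bounded_operators_linear(1)[OF X])
  obtain K where K: "K > 0" "\<And>x. norm (X x) \<le> K * norm x" by (rule bounded_operators_bound[OF X]) auto
  define U where "U = {x. norm x = 1 \<and> (\<forall>f\<in>F. cinner x f = 0)}"
  define s where "s = Sup ((\<lambda>x. norm (X x)) ` U)"
  obtain x0 where x0: "x0 \<in> U" using ex_unit_orthogonal[OF inf F] by (auto simp: U_def)
  have bdd: "bdd_above ((\<lambda>x. norm (X x)) ` U)"
  proof (rule bdd_aboveI2)
    show "norm (X x) \<le> K" if "x \<in> U" for x using K(2)[of x] that by (simp add: U_def)
  qed
  have le_s: "norm (X x) \<le> s" if "x \<in> U" for x
    unfolding s_def using bdd that by (intro cSUP_upper)
  have le_s': "norm (X x) \<le> s * norm x" if "\<forall>f\<in>F. cinner x f = 0" for x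
  proof (cases "x = 0")
    case False
    have "complex_of_real (1 / norm x) *\<^sub>C x \<in> U"
      using that False by (simp add: U_def norm_scaleC cinner_scaleC_left norm_divide)
    from le_s[OF this] False show ?thesis
      by (simp add: bounded_operators_linear(2)[OF X] norm_scaleC norm_divide field_simps)
  qed simp
  have "\<exists>u\<in>U. s \<le> norm (X u)"
  proof (cases "s \<le> 0")
    case True
    then show ?thesis using x0 by (intro bexI[of _ x0]) (auto intro: order_trans)
  next
    case False
    then have s: "s > 0" by simp
    have "\<exists>x\<in>U. s - 1 / real (Suc k) < norm (X x)" for k
    proof -
      have "s - 1 / real (Suc k) < Sup ((\<lambda>x. norm (X x)) ` U)" unfolding s_def[symmetric] by simp
      then show ?thesis using less_cSup_iff[OF _ bdd] x0 by auto
    qed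
    then obtain x where x: "\<And>k. x k \<in> U" "\<And>k. s - 1 / real (Suc k) < norm (X (x k))" by metis
    have "X (x k) \<in> closure (X ` cball 0 1)" for k
      using x(1)[of k] closure_subset by (force simp: U_def)
    then obtain y r where r: "strict_mono r" and lim: "((\<lambda>k. X (x k)) \<circ> r) \<longlonglongrightarrow> y"
      using compact[unfolded compact_def, rule_format, of "\<lambda>k. X (x k)"] by blast
    have norm_lim: "(\<lambda>k. norm (X (x k))) \<longlonglongrightarrow> s"
    proof (rule real_tendsto_sandwich)
      show "(\<lambda>k. s - 1 / real (Suc k)) \<longlonglongrightarrow> s"
        using LIMSEQ_inverse_real_of_nat_add_minus[of s] by (simp add: inverse_eq_divide)
      show "\<forall>\<^sub>F k in sequentially. s - 1 / real (Suc k) \<le> norm (X (x k))"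
        using x(2) by (intro always_eventually allI less_imp_le)
      show "\<forall>\<^sub>F k in sequentially. norm (X (x k)) \<le> s"
        using le_s[OF x(1)] by (intro always_eventually allI)
    qed simp
    have y: "norm y = s"
      using LIMSEQ_unique[OF tendsto_norm[OF lim[unfolded o_def]] LIMSEQ_subseq_LIMSEQ[OF norm_lim r, unfolded o_def]] .
    define w where "w = x \<circ> r"
    have wU: "w k \<in> U" for k using x(1) by (simp add: w_def)
    have Xw: "(\<lambda>k. X (w k)) \<longlonglongrightarrow> y" using lim by (simp add: w_def o_def)
    have "Cauchy w"
      unfolding Cauchy_def
    proof (intro allI impI)
      fix \<epsilon> :: real assume \<epsilon>: "\<epsilon> > 0"
      \<comment> \<open>With this choice \<open>2 - \<parallel>w\<^sub>k + w\<^sub>l\<parallel> < \<epsilon>\<^sup>2 / 8\<close>, and the parallelogram law loses at most a factor \<open>4\<close>.\<close>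
      define \<delta> where "\<delta> = s * \<epsilon>\<^sup>2 / 16"
      have "\<delta> > 0" using s \<epsilon> by (simp add: \<delta>_def)
      then obtain N where N: "\<And>k. k \<ge> N \<Longrightarrow> norm (X (w k) - y) < \<delta>"
        using LIMSEQ_D[OF Xw] by blast
      have "dist (w k) (w l) < \<epsilon>" if "k \<ge> N" "l \<ge> N" for k l
      proof -
        define n where "n = norm (w k + w l)"
        have "\<forall>f\<in>F. cinner (w k + w l) f = 0" using wU by (auto simp: U_def cinner_add_left)
        then have "norm (X (w k + w l)) \<le> s * n" unfolding n_def by (rule le_s')
        moreover have "2 * s \<le> norm (X (w k + w l)) + norm (X (w k) - y) + norm (X (w l) - y)"
        proof -
          have "2 * s = norm (2 *\<^sub>R y)" by (simp add: y)
          also have "2 *\<^sub>R y = X (w k + w l) - (X (w k) - y) - (X (w l) - y)"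
            by (simp add: X.add scaleR_2)
          also have "norm \<dots> \<le> norm (X (w k + w l)) + norm (X (w k) - y) + norm (X (w l) - y)"
            by (meson add_right_mono norm_triangle_ineq4 order_trans)
          finally show ?thesis .
        qed
        ultimately have "s * (2 - n) < 2 * \<delta>"
          using N[OF that(1)] N[OF that(2)] by (simp add: algebra_simps)
        then have "2 - n < \<epsilon>\<^sup>2 / 8" using s by (simp add: \<delta>_def)
        moreover have "n \<le> 2" unfolding n_def
          using norm_triangle_ineq[of "w k" "w l"] wU[of k] wU[of l] by (simp add: U_def)
        moreover have "0 \<le> n" by (simp add: n_def)
        moreover have "(norm (w k - w l))\<^sup>2 = (2 - n) * (2 + n)"
        proof -
          have "(norm (w k + w l))\<^sup>2 + (norm (w k - w l))\<^sup>2 = 4"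
            using wU[of k] wU[of l]
            by (simp add: U_def norm_eq_1 power2_norm_eq_inner inner_add_left inner_add_right
                inner_diff_left inner_diff_right)
          then show ?thesis by (simp add: n_def power2_eq_square algebra_simps)
        qed
        moreover have "(2 - n) * (2 + n) \<le> (2 - n) * 4"
          using \<open>n \<le> 2\<close> by (intro mult_left_mono) auto
        ultimately have "(norm (w k - w l))\<^sup>2 < \<epsilon>\<^sup>2" using \<epsilon> by (simp add: zero_less_power)
        then show ?thesis using \<epsilon> by (simp add: dist_norm power2_less_imp_less)
      qed
      then show "\<exists>N. \<forall>k\<ge>N. \<forall>l\<ge>N. dist (w k) (w l) < \<epsilon>" by blast
    qed
    then obtain u where u: "w \<longlonglongrightarrow> u" using Cauchy_convergent_iff convergent_def by blast
    have "norm u = 1"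
      using LIMSEQ_unique[OF tendsto_norm[OF u]] wU by (simp add: U_def)
    moreover have "cinner u f = 0" if "f \<in> F" for f
      using LIMSEQ_unique[OF bounded_linear.tendsto[OF cinner.bounded_linear_left[of f] u]] wU that
      by (simp add: U_def)
    moreover have "X u = y" using LIMSEQ_unique[OF X.tendsto[OF u] Xw] .
    ultimately show ?thesis using y by (intro bexI[of _ u]) (auto simp: U_def)
  qed
  then obtain u where "u \<in> U" "s \<le> norm (X u)" by blast
  moreover have "norm (X x) \<le> norm (X u) * norm x" if "\<forall>f\<in>F. cinner x f = 0" for x
    using le_s'[OF that] mult_right_mono[OF \<open>s \<le> norm (X u)\<close>, of "norm x"] by simp
  ultimately show ?thesis unfolding U_def by blast
qed

text \<open>
  First-order optimality. With \<open>h = \<langle>X u, X w\<rangle>\<close>, moving from \<open>u\<close> in the direction \<open>h w\<close>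
  would increase \<open>\<parallel>X u\<parallel>\<^sup>2\<close> to first order, at only second-order cost in the norm of the
  argument, unless \<open>h = 0\<close>.
\<close>

lemma norm_maximizer_orthogonal_image:
  fixes X :: "'a::complex_hilbert \<Rightarrow> 'a"
  assumes X: "X \<in> bounded_operators" and u: "norm u = 1" and uw: "cinner u w = 0"
    and max: "\<And>t. norm (X (u + t *\<^sub>C w)) \<le> norm (X u) * norm (u + t *\<^sub>C w)"
  shows "cinner (X u) (X w) = 0"
proof (rule ccontr)
  assume "cinner (X u) (X w) \<noteq> 0"
  define h where "h = cinner (X u) (X w)"
  define s where "s = (norm (X u))\<^sup>2 * (norm w)\<^sup>2"
  have h: "(cmod h)\<^sup>2 > 0" using \<open>cinner (X u) (X w) \<noteq> 0\<close> by (simp add: h_def)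
  have s: "s \<ge> 0" by (simp add: s_def)
  interpret X: bounded_linear X by (rule bounded_operators_linear(1)[OF X])
  \<comment> \<open>Any positive step size with \<open>\<tau> s < 2\<close> contradicts maximality.\<close>
  define \<tau> where "\<tau> = 1 / (1 + s)"
  have \<tau>: "\<tau> > 0" "\<tau> * s < 1" using s by (auto simp: \<tau>_def)
  define t where "t = complex_of_real \<tau> * h"
  have "cinner (X u) (t *\<^sub>C X w) = complex_of_real (\<tau> * (cmod h)\<^sup>2)"
    unfolding t_def cinner_scaleC_right h_def[symmetric] of_real_mult complex_norm_square by simp
  then have "inner (X u) (t *\<^sub>C X w) = \<tau> * (cmod h)\<^sup>2" by (simp only: inner_eq_Re_cinner Re_complex_of_real)
  then have "(norm (X u))\<^sup>2 + 2 * \<tau> * (cmod h)\<^sup>2 \<le> (norm (X u + t *\<^sub>C X w))\<^sup>2"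
    by (simp add: power2_norm_eq_inner inner_add_left inner_add_right inner_commute)
  also have "\<dots> \<le> (norm (X u) * norm (u + t *\<^sub>C w))\<^sup>2"
    using max[of t] by (intro power_mono) (simp_all add: X.add bounded_operators_linear(2)[OF X])
  also have "\<dots> = (norm (X u))\<^sup>2 * (1 + (cmod t)\<^sup>2 * (norm w)\<^sup>2)"
    using norm_add_orthogonal[of u "t *\<^sub>C w"] uw u
    by (simp add: power_mult_distrib norm_scaleC cinner_scaleC_right)
  also have "\<dots> = (norm (X u))\<^sup>2 + \<tau> * (\<tau> * s) * (cmod h)\<^sup>2"
    by (simp add: t_def s_def norm_mult power_mult_distrib algebra_simps power2_eq_square)
  finally have "(2 * \<tau>) * (cmod h)\<^sup>2 \<le> (\<tau> * (\<tau> * s)) * (cmod h)\<^sup>2" by simp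
  then have "2 * \<tau> \<le> \<tau> * (\<tau> * s)" using h by (simp only: mult_le_cancel_right)
  also have "\<dots> < \<tau> * 1" using \<tau> by (intro mult_strict_left_mono)
  finally show False using \<tau> by simp
qed

text \<open>
  Choose \<open>u\<^sub>n\<close> as a maximiser of the norm of \<open>X\<close> on the unit vectors orthogonal to
  \<open>u\<^sub>0, \<dots>, u\<^bsub>n-1\<^esub>\<close>. Optimality makes the images \<open>X u\<^sub>n\<close> orthogonal, and their norms \<open>\<xi>\<^sub>n\<close>
  decrease. The norms tend to \<open>0\<close>, as otherwise the \<open>X u\<^sub>n\<close> would be a separated sequence in
  a compact set. Since \<open>\<xi>\<^sub>N\<close> is the norm of \<open>X\<close> on what the first \<open>N\<close> vectors leave over,
  the series converges to \<open>X\<close>.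
\<close>

theorem Schmidt_decomposition:
  fixes X :: "'a::complex_hilbert \<Rightarrow> 'a"
  assumes inf: "infinite_dimensional TYPE('a)" and X: "X \<in> bounded_operators"
    and compact: "compact (closure (X ` cball 0 1))"
  obtains \<xi> u v where "\<xi> \<in> c0_star" "orthonormal u UNIV" "orthogonal_contractions v UNIV"
    "\<And>n. \<xi> n \<noteq> 0 \<Longrightarrow> norm (v n) = 1" "X = schmidt_op \<xi> u v"
proof -
  interpret X: bounded_linear X by (rule bounded_operators_linear(1)[OF X])
  have "\<exists>u :: nat \<Rightarrow> 'a. \<forall>n. norm (u n) = 1 \<and> (\<forall>f\<in>u ` {..<n}. cinner (u n) f = 0) \<and>
    (\<forall>y. (\<forall>f\<in>u ` {..<n}. cinner y f = 0) \<longrightarrow> norm (X y) \<le> norm (X (u n)) * norm y)"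
  proof (rule dependent_wellorder_choice[where P="\<lambda>u n x. norm x = 1 \<and>
      (\<forall>f\<in>u ` {..<n}. cinner x f = 0) \<and>
      (\<forall>y. (\<forall>f\<in>u ` {..<n}. cinner y f = 0) \<longrightarrow> norm (X y) \<le> norm (X x) * norm y)"])
    fix r :: 'a and f g :: "nat \<Rightarrow> 'a" and n :: nat
    assume fg: "\<And>j. j < n \<Longrightarrow> f j = g j"
    then have "f ` {..<n} = g ` {..<n}" by (auto intro!: image_cong)
    then show "(norm r = 1 \<and> (\<forall>f\<in>f ` {..<n}. cinner r f = 0) \<and>
        (\<forall>y. (\<forall>f\<in>f ` {..<n}. cinner y f = 0) \<longrightarrow> norm (X y) \<le> norm (X r) * norm y)) =
      (norm r = 1 \<and> (\<forall>f\<in>g ` {..<n}. cinner r f = 0) \<and>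
        (\<forall>y. (\<forall>f\<in>g ` {..<n}. cinner y f = 0) \<longrightarrow> norm (X y) \<le> norm (X r) * norm y))" by simp
  qed (rule ex_norm_attained[OF inf X compact], simp)
  then obtain u :: "nat \<Rightarrow> 'a" where *: "\<And>n. norm (u n) = 1 \<and> (\<forall>f\<in>u ` {..<n}. cinner (u n) f = 0) \<and>
    (\<forall>y. (\<forall>f\<in>u ` {..<n}. cinner y f = 0) \<longrightarrow> norm (X y) \<le> norm (X (u n)) * norm y)" by blast
  have u1: "norm (u n) = 1" for n using *[of n] by blast
  have perp: "cinner (u n) (u j) = 0" if "j < n" for n j using *[of n] that by blast
  have max: "norm (X y) \<le> norm (X (u n)) * norm y" if "\<And>j. j < n \<Longrightarrow> cinner y (u j) = 0" for n y
    using *[of n] that by auto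
  have perp': "cinner (u i) (u j) = 0" if "i \<noteq> j" for i j
    using perp that cinner_eq_0_commute by (metis nat_neq_iff)
  have u: "orthonormal u UNIV" using u1 perp' by (simp add: orthonormal_def)
  define \<xi> where "\<xi> n = norm (X (u n))" for n
  \<comment> \<open>If \<open>\<xi> n = 0\<close>, then \<open>v n = 0\<close>, because division by zero yields zero.\<close>
  define v where "v n = complex_of_real (1 / \<xi> n) *\<^sub>C X (u n)" for n
  have "cinner (X (u n)) (X (u m)) = 0" if "n < m" for n m
    using that perp' by (intro norm_maximizer_orthogonal_image[OF X] u1 max)
      (auto simp: cinner_add_left cinner_scaleC_left)
  then have Xperp: "cinner (X (u n)) (X (u m)) = 0" if "n \<noteq> m" for n m
    using that cinner_eq_0_commute by (metis nat_neq_iff)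
  have v1: "norm (v n) = 1" if "\<xi> n \<noteq> 0" for n
    using that by (simp add: v_def \<xi>_def norm_scaleC norm_divide)
  moreover have "norm (v n) = 0" if "\<xi> n = 0" for n
    using that by (simp add: v_def \<xi>_def)
  ultimately have v: "orthogonal_contractions v UNIV"
    unfolding orthogonal_contractions_def
    by (intro conjI ballI impI) (metis order_refl zero_le_one,
        simp add: v_def cinner_scaleC_left cinner_scaleC_right Xperp)
  have dec: "decseq \<xi>"
    unfolding decseq_Suc_iff \<xi>_def
  proof
    fix n show "norm (X (u (Suc n))) \<le> norm (X (u n))"
      using max[of n "u (Suc n)"] perp'[of "Suc n"] u1 by simp
  qed
  have "\<xi> \<longlonglongrightarrow> 0"
  proof -
    have pos: "\<xi> n \<ge> 0" for n by (simp add: \<xi>_def)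
    then obtain L where L: "\<xi> \<longlonglongrightarrow> L" "\<And>n. L \<le> \<xi> n" using decseq_convergent[OF dec, of 0] by blast
    have "L = 0"
    proof (rule ccontr)
      assume "L \<noteq> 0"
      moreover have "L \<ge> 0" using LIMSEQ_le_const[OF L(1)] pos by blast
      ultimately have Lp: "L > 0" by simp
      have "X (u n) \<in> closure (X ` cball 0 1)" for n
        using u1[of n] closure_subset by (metis (no_types, lifting) image_eqI mem_cball_0 order_refl subset_iff)
      then obtain y r where r: "strict_mono r" and lim: "((\<lambda>n. X (u n)) \<circ> r) \<longlonglongrightarrow> y"
        using compact[unfolded compact_def, rule_format, of "\<lambda>n. X (u n)"] by blast
      then obtain N where N: "\<And>k l. k \<ge> N \<Longrightarrow> l \<ge> N \<Longrightarrow> dist (X (u (r k))) (X (u (r l))) < L"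
        using LIMSEQ_imp_Cauchy[OF lim] Lp unfolding Cauchy_def o_def by blast
      have "r N \<noteq> r (Suc N)" using r by (metis n_not_Suc_n strict_mono_eq)
      then have "cinner (X (u (r N))) (- X (u (r (Suc N)))) = 0" by (simp add: cinner.minus_right Xperp)
      from norm_add_orthogonal[OF this]
      have "(dist (X (u (r N))) (X (u (r (Suc N)))))\<^sup>2 = (\<xi> (r N))\<^sup>2 + (\<xi> (r (Suc N)))\<^sup>2"
        by (simp add: dist_norm \<xi>_def)
      moreover have "L\<^sup>2 \<le> (\<xi> (r N))\<^sup>2" using L(2) Lp by (intro power_mono) auto
      ultimately have "L\<^sup>2 \<le> (dist (X (u (r N))) (X (u (r (Suc N)))))\<^sup>2"
        using zero_le_power2[of "\<xi> (r (Suc N))"] by linarith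
      then have "L \<le> dist (X (u (r N))) (X (u (r (Suc N))))" by (rule power2_le_imp_le) simp
      with N[of N "Suc N"] show False by simp
    qed
    with L show ?thesis by simp
  qed
  then have \<xi>: "\<xi> \<in> c0_star" using dec by (auto simp: c0_star_def \<xi>_def)
  have coeff: "(complex_of_real (\<xi> n) * c) *\<^sub>C v n = c *\<^sub>C X (u n)" for n c
    by (cases "\<xi> n = 0") (auto simp: v_def scaleC_scaleC \<xi>_def)
  have "schmidt_op \<xi> u v x = X x" for x
  proof -
    define p where "p N = (\<Sum>n<N. cinner x (u n) *\<^sub>C u n)" for N
    have "norm (X x - X (p N)) \<le> \<xi> N * norm x" for N
    proof -
      have uN: "orthonormal u {..<N}" using u by (rule orthonormal_subset) simp
      have "norm (X (x - p N)) \<le> \<xi> N * norm (x - p N)"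
        unfolding p_def \<xi>_def using orthogonal_residual[OF uN] by (intro max) auto
      also have "\<dots> \<le> \<xi> N * norm x"
        unfolding p_def using norm_residual_le[OF uN] by (intro mult_left_mono) (auto simp: \<xi>_def)
      finally show ?thesis by (simp add: X.diff)
    qed
    from Lim_null_comparison[OF always_eventually[OF allI[OF this]] tendsto_mult_left_zero[OF \<open>\<xi> \<longlonglongrightarrow> 0\<close>]]
    have "(\<lambda>N. X x - X (p N)) \<longlonglongrightarrow> 0" .
    then have "(\<lambda>N. X (p N)) \<longlonglongrightarrow> X x"
      using tendsto_diff[OF tendsto_const[of "X x"], of "\<lambda>N. X x - X (p N)" 0] by simp
    moreover have "X (p N) = (\<Sum>n<N. (complex_of_real (\<xi> n) * cinner x (u n)) *\<^sub>C v n)" for N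
      by (simp add: p_def X.sum bounded_operators_linear(2)[OF X] coeff)
    ultimately have "(\<lambda>n. (complex_of_real (\<xi> n) * cinner x (u n)) *\<^sub>C v n) sums X x"
      by (simp add: sums_def)
    then show ?thesis by (simp add: schmidt_op_def sums_iff)
  qed
  then have "X = schmidt_op \<xi> u v" by auto
  with that[OF \<xi> u v v1] show ?thesis by blast
qed

section \<open>Singular values and the injectivity of the Calkin correspondence\<close>

lemma c0_star_nonneg: "\<xi> \<in> c0_star \<Longrightarrow> 0 \<le> \<xi> n"
  and c0_star_antimono: "\<xi> \<in> c0_star \<Longrightarrow> m \<le> n \<Longrightarrow> \<xi> n \<le> \<xi> m"
  and c0_star_lim: "\<xi> \<in> c0_star \<Longrightarrow> \<xi> \<longlonglongrightarrow> 0"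
  by (auto simp: c0_star_def decseq_def)

lemma c0_star_bounded: "\<xi> \<in> c0_star \<Longrightarrow> bounded (range \<xi>)"
  using c0_star_lim convergent_imp_bounded by blast

lemma finite_level_c0_star:
  assumes "\<xi> \<in> c0_star" "\<sigma> > 0" shows "finite {n. \<xi> n = \<sigma>}"
proof -
  have "\<forall>\<^sub>F n in sequentially. \<xi> n < \<sigma>"
    using order_tendstoD(2)[OF c0_star_lim[OF assms(1)] assms(2)] .
  then obtain N where "\<And>n. n \<ge> N \<Longrightarrow> \<xi> n < \<sigma>" by (auto simp: eventually_sequentially)
  then have "{n. \<xi> n = \<sigma>} \<subseteq> {..<N}" by (force simp: not_le[symmetric])
  then show ?thesis using finite_subset by blast
qed

text \<open>
  A decreasing null sequence is determined by how often it takes each positive value. At the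
  first index where two such sequences differ, the larger value is taken more often by the
  larger one.
\<close>

lemma c0_star_eqI:
  assumes \<xi>: "\<xi> \<in> c0_star" and \<eta>: "\<eta> \<in> c0_star"
    and card: "\<And>\<sigma>. \<sigma> > 0 \<Longrightarrow> card {n. \<xi> n = \<sigma>} = card {n. \<eta> n = \<sigma>}"
  shows "\<xi> = \<eta>"
proof (rule ccontr)
  assume "\<xi> \<noteq> \<eta>"
  then have ex: "\<exists>n. \<xi> n \<noteq> \<eta> n" by auto
  define n where "n = (LEAST n. \<xi> n \<noteq> \<eta> n)"
  have n: "\<xi> n \<noteq> \<eta> n" and eq: "\<And>m. m < n \<Longrightarrow> \<xi> m = \<eta> m"
    unfolding n_def using LeastI_ex[OF ex] not_less_Least by blast+
  have False if \<xi>: "\<xi> \<in> c0_star" and \<eta>: "\<eta> \<in> c0_star" and less: "\<eta> n < \<xi> n"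
    and eq: "\<And>m. m < n \<Longrightarrow> \<xi> m = \<eta> m"
    and card: "\<And>\<sigma>. \<sigma> > 0 \<Longrightarrow> card {n. \<xi> n = \<sigma>} = card {n. \<eta> n = \<sigma>}" for \<xi> \<eta>
  proof -
    have pos: "\<xi> n > 0" using less c0_star_nonneg[OF \<eta>, of n] by linarith
    have "m < n" if "\<eta> m = \<xi> n" for m
      using that less c0_star_antimono[OF \<eta>, of n m] by (cases "n \<le> m") auto
    then have "{m. \<eta> m = \<xi> n} \<subset> {m. \<xi> m = \<xi> n}" using eq less by force
    from psubset_card_mono[OF finite_level_c0_star[OF \<xi> pos] this] card[OF pos] show False by simp
  qed
  from this[OF \<xi> \<eta> _ eq card] this[OF \<eta> \<xi> _ eq[symmetric] card[symmetric]] n show False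
    by (metis linorder_neqE_linordered_idom)
qed

lemma orthonormal_inj_on: "orthonormal u S \<Longrightarrow> inj_on u S"
  using orthonormal_dist by (force intro!: inj_onI)

lemma orthonormal_independent:
  fixes u :: "'i \<Rightarrow> 'a::complex_hilbert"
  assumes "orthonormal u S"
  shows "complex_vector.independent (u ` S)"
  unfolding complex_vector.independent_explicit_module
proof (intro allI impI)
  fix T c and y :: 'a
  assume T: "finite T" "T \<subseteq> u ` S" "(\<Sum>v\<in>T. c v *\<^sub>C v) = 0" "y \<in> T"
  have on: "orthonormal (\<lambda>x. x) T"
  proof -
    have *: "\<exists>i\<in>S. x = u i" if "x \<in> T" for x using T(2) that by blast
    show ?thesis using assms unfolding orthonormal_def by (metis *)
  qed
  from cinner_sum_orthogonal[OF orthonormal_imp_contractions[OF on] T(1,4), of c] T(3,4) on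
  show "c y = 0" by (auto simp: orthonormal_def)
qed

text \<open>
  A bounded operator has at most one adjoint, and exchanging the two families provides it.
\<close>

lemma adjoint_schmidt_op:
  assumes a: "bounded (range a)" and u: "orthogonal_contractions u UNIV"
    and v: "orthogonal_contractions v UNIV"
  shows "adjoint_operator (schmidt_op a u v) = schmidt_op a v u"
  unfolding adjoint_operator_def
proof (rule the_equality)
  show "schmidt_op a v u \<in> bounded_operators \<and>
      (\<forall>x y. cinner (schmidt_op a u v x) y = cinner x (schmidt_op a v u y))"
    using schmidt_op_bounded[OF a v u] schmidt_op_adjoint[OF a u v] by blast
next
  fix Y assume "Y \<in> bounded_operators \<and> (\<forall>x y. cinner (schmidt_op a u v x) y = cinner x (Y y))"
  then have "cinner x (Y y) = cinner x (schmidt_op a v u y)" for x y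
    using schmidt_op_adjoint[OF a u v] by metis
  then show "Y = schmidt_op a v u"
    by (intro ext cinner_ext) (metis cinner_commute)
qed

text \<open>
  Here \<open>X\<^sup>* X = \<Sum> \<xi>\<^sub>n\<^sup>2 \<langle>\<cdot>, u\<^sub>n\<rangle> u\<^sub>n\<close>, so comparing coordinates shows that the eigenspace of
  \<open>\<sigma>\<^sup>2 > 0\<close> is spanned by the \<open>u\<^sub>n\<close> with \<open>\<xi>\<^sub>n = \<sigma>\<close>.
\<close>

lemma s_numbers_schmidt_op:
  assumes \<xi>: "\<xi> \<in> c0_star" and u: "orthonormal u UNIV" and v: "orthogonal_contractions v UNIV"
    and v1: "\<And>n. \<xi> n \<noteq> 0 \<Longrightarrow> norm (v n) = 1"
  shows "s_numbers (schmidt_op \<xi> u v) = \<xi>"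
proof -
  note uc = orthonormal_imp_contractions[OF u]
  note bd = c0_star_bounded[OF \<xi>]
  let ?X = "schmidt_op \<xi> u v"
  define T where "T = schmidt_op (\<lambda>n. (\<xi> n)\<^sup>2) u u"
  have bd2: "bounded (range (\<lambda>n. (\<xi> n)\<^sup>2))"
    using tendsto_power[OF c0_star_lim[OF \<xi>]] convergent_imp_bounded by blast
  have T: "adjoint_operator ?X (?X x) = T x" for x
  proof -
    have "\<xi> n * \<xi> n * (norm (v n))\<^sup>2 = (\<xi> n)\<^sup>2" for n
      using v1[of n] by (cases "\<xi> n = 0") (auto simp: power2_eq_square)
    then have "schmidt_op \<xi> v u \<circ> ?X = T"
      using schmidt_op_compose[OF bd bd uc v, of u] by (simp add: T_def)
    then show ?thesis by (simp add: adjoint_schmidt_op[OF bd uc v] fun_eq_iff)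
  qed
  interpret T: bounded_linear T
    unfolding T_def by (rule bounded_operators_linear(1)[OF schmidt_op_bounded[OF bd2 uc uc]])
  have Tc: "T (c *\<^sub>C x) = c *\<^sub>C T x" for c x
    unfolding T_def by (rule bounded_operators_linear(2)[OF schmidt_op_bounded[OF bd2 uc uc]])
  have dim: "complex_vector.dim {x. T x = complex_of_real (\<sigma>\<^sup>2) *\<^sub>C x} = card {n. \<xi> n = \<sigma>}"
    if \<sigma>: "\<sigma> > 0" for \<sigma>
  proof -
    define N where "N = {n. \<xi> n = \<sigma>}"
    have N: "finite N" unfolding N_def by (rule finite_level_c0_star[OF \<xi> \<sigma>])
    have "{x. T x = complex_of_real (\<sigma>\<^sup>2) *\<^sub>C x} = complex_vector.span (u ` N)"
    proof
      show "{x. T x = complex_of_real (\<sigma>\<^sup>2) *\<^sub>C x} \<subseteq> complex_vector.span (u ` N)"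
      proof
        fix x assume "x \<in> {x. T x = complex_of_real (\<sigma>\<^sup>2) *\<^sub>C x}"
        then have x: "T x = complex_of_real (\<sigma>\<^sup>2) *\<^sub>C x" by simp
        have zero: "cinner x (u k) = 0" if "k \<notin> N" for k
        proof -
          have "complex_of_real (\<sigma>\<^sup>2) * cinner x (u k) = complex_of_real ((\<xi> k)\<^sup>2) * cinner x (u k)"
            using cinner_schmidt_op_range[OF bd2 uc uc, of x k] u
            by (simp add: T_def[symmetric] x cinner_scaleC_left orthonormal_def)
          moreover have "\<sigma>\<^sup>2 \<noteq> (\<xi> k)\<^sup>2"
            using that \<sigma> c0_star_nonneg[OF \<xi>, of k] by (auto simp: N_def power2_eq_iff_nonneg)
          ultimately show ?thesis using of_real_eq_iff mult_right_cancel by metis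
        qed
        have "T x = (\<Sum>n\<in>N. (complex_of_real ((\<xi> n)\<^sup>2) * cinner x (u n)) *\<^sub>C u n)"
          unfolding T_def schmidt_op_def using N zero by (intro suminf_finite) auto
        also have "\<dots> \<in> complex_vector.span (u ` N)"
          by (intro complex_vector.span_sum complex_vector.span_scale complex_vector.span_base imageI)
        finally have "complex_of_real (1 / \<sigma>\<^sup>2) *\<^sub>C T x \<in> complex_vector.span (u ` N)"
          by (rule complex_vector.span_scale)
        then show "x \<in> complex_vector.span (u ` N)"
          using \<sigma> by (simp add: x scaleC_scaleC scaleC_one flip: of_real_mult)
      qed
      have "T (u n) = complex_of_real (\<sigma>\<^sup>2) *\<^sub>C u n" if "n \<in> N" for n
        using schmidt_op_basis[OF bd2 uc uc, of n] u that
        by (simp add: T_def N_def orthonormal_def)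
      moreover have "complex_vector.subspace {x. T x = complex_of_real (\<sigma>\<^sup>2) *\<^sub>C x}"
        by (rule complex_vector.subspaceI)
          (auto simp: T.add Tc scaleC_add_right scaleC_scaleC mult.commute T.zero)
      ultimately show "complex_vector.span (u ` N) \<subseteq> {x. T x = complex_of_real (\<sigma>\<^sup>2) *\<^sub>C x}"
        by (intro complex_vector.span_minimal) auto
    qed
    then have "complex_vector.dim {x. T x = complex_of_real (\<sigma>\<^sup>2) *\<^sub>C x} = card (u ` N)"
      using orthonormal_independent[OF orthonormal_subset[OF u]]
      by (simp add: complex_vector.dim_eq_card_independent)
    then show ?thesis
      using card_image[OF orthonormal_inj_on[OF orthonormal_subset[OF u]], of N] by (simp add: N_def)
  qed
  show ?thesis
    unfolding s_numbers_def T using \<xi> dim by (intro the_equality c0_star_eqI) auto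
qed

text \<open>
  Partial isometries carry a pair of families that are normalised wherever the coefficients
  do not vanish to any other pair, so membership of a Schmidt series in an ideal is a matter
  of its coefficients.
\<close>

lemma schmidt_op_in_ideal:
  assumes I: "operator_ideal I" and X: "schmidt_op \<xi> u v \<in> I" and \<xi>: "\<xi> \<in> c0_star"
    and u: "orthonormal u UNIV" and v: "orthogonal_contractions v UNIV"
    and v1: "\<And>n. \<xi> n \<noteq> 0 \<Longrightarrow> norm (v n) = 1"
    and u': "orthogonal_contractions u' UNIV" and v': "orthogonal_contractions v' UNIV"
  shows "schmidt_op \<xi> u' v' \<in> I"
proof -
  note bd = c0_star_bounded[OF \<xi>]
  note uc = orthonormal_imp_contractions[OF u]
  have one: "bounded (range (\<lambda>_::nat. 1 :: real))" by simp
  have 1: "schmidt_op \<xi> u v \<circ> schmidt_op (\<lambda>_. 1) u' u = schmidt_op \<xi> u' v"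
    using schmidt_op_compose[OF one bd u' uc, of v] u by (simp add: orthonormal_def)
  have eq: "(\<lambda>n. 1 * \<xi> n * (norm (v n))\<^sup>2) = \<xi>" using v1 by fastforce
  have 2: "schmidt_op (\<lambda>_. 1) v v' \<circ> schmidt_op \<xi> u' v = schmidt_op \<xi> u' v'"
    using schmidt_op_compose[OF bd one u' v, of v'] by (simp only: eq)
  have "schmidt_op (\<lambda>_. 1) u' u \<in> bounded_operators" "schmidt_op (\<lambda>_. 1) v v' \<in> bounded_operators"
    by (rule schmidt_op_bounded[OF one]; fact u' v v' uc)+
  then show ?thesis using I X unfolding operator_ideal_def 1[symmetric] 2[symmetric] by blast
qed

lemma ideal_Schmidt:
  fixes X :: "'a::complex_hilbert \<Rightarrow> 'a" and e :: "nat \<Rightarrow> 'a"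
  assumes inf: "infinite_dimensional TYPE('a)" and e: "orthonormal_basis e"
    and I: "operator_ideal I" and X: "X \<in> I"
  obtains u v where "s_numbers X \<in> c0_star" "X = schmidt_op (s_numbers X) u v"
    "orthonormal u UNIV" "orthogonal_contractions v UNIV"
    "\<And>n. s_numbers X n \<noteq> 0 \<Longrightarrow> norm (v n) = 1"
proof -
  have "X \<in> bounded_operators" using I X by (auto simp: operator_ideal_def)
  from Schmidt_decomposition[OF inf this compact_closure_image_ball[OF e I X]]
  obtain \<xi> u v where *: "\<xi> \<in> c0_star" "orthonormal u UNIV" "orthogonal_contractions v UNIV"
    "\<And>n. \<xi> n \<noteq> 0 \<Longrightarrow> norm (v n) = 1" "X = schmidt_op \<xi> u v" by blast
  then have "s_numbers X = \<xi>" using s_numbers_schmidt_op by metis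
  with * that show ?thesis by metis
qed

text \<open>
  Multiplication by partial isometries turns an operator of the ideal into the diagonal
  operator of its singular values. From here on, the diagonal operators of one fixed basis
  stand for the singular values.
\<close>

lemma characteristic_set_iff:
  fixes I :: "('a::complex_hilbert \<Rightarrow> 'a) set"
  assumes inf: "infinite_dimensional TYPE('a)" and e: "orthonormal_basis e" and I: "operator_ideal I"
  shows "\<xi> \<in> characteristic_set I \<longleftrightarrow> \<xi> \<in> c0_star \<and> schmidt_op \<xi> e e \<in> I"
proof
  have eo: "orthonormal e UNIV" using e by (simp add: orthonormal_basis_def)
  note ec = orthonormal_imp_contractions[OF eo]
  show "\<xi> \<in> c0_star \<and> schmidt_op \<xi> e e \<in> I" if char: "\<xi> \<in> characteristic_set I"
  proof -
    obtain X where X: "X \<in> I" "\<xi> = s_numbers X" using char unfolding characteristic_set_def by blast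
    from ideal_Schmidt[OF inf e I X(1), folded X(2)] X(1) show ?thesis
      using schmidt_op_in_ideal[OF I _ _ _ _ _ ec ec] by metis
  qed
  show "\<xi> \<in> characteristic_set I" if "\<xi> \<in> c0_star \<and> schmidt_op \<xi> e e \<in> I"
  proof -
    have "s_numbers (schmidt_op \<xi> e e) = \<xi>"
      using that eo ec by (intro s_numbers_schmidt_op) (auto simp: orthonormal_def)
    then show ?thesis using that unfolding characteristic_set_def by force
  qed
qed

text \<open>
  The order-embedding half of Calkin's theorem: an operator lies in an ideal as soon as the
  diagonal operator of its singular values does.
\<close>

lemma ideal_subset_iff:
  fixes I J :: "('a::complex_hilbert \<Rightarrow> 'a) set"
  assumes inf: "infinite_dimensional TYPE('a)" and sep: "separable TYPE('a)"
    and I: "operator_ideal I" and J: "operator_ideal J"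
  shows "I \<subseteq> J \<longleftrightarrow> characteristic_set I \<subseteq> characteristic_set J"
proof
  show "I \<subseteq> J" if sub: "characteristic_set I \<subseteq> characteristic_set J"
  proof
    obtain e :: "nat \<Rightarrow> 'a" where e: "orthonormal_basis e" using ex_orthonormal_basis[OF inf sep] by blast
    then have eo: "orthonormal e UNIV" by (simp add: orthonormal_basis_def)
    fix X assume X: "X \<in> I"
    obtain u v where *: "s_numbers X \<in> c0_star" "X = schmidt_op (s_numbers X) u v"
      "orthonormal u UNIV" "orthogonal_contractions v UNIV" using ideal_Schmidt[OF inf e I X] by metis
    have "s_numbers X \<in> characteristic_set J" using sub X by (auto simp: characteristic_set_def)
    then have "schmidt_op (s_numbers X) e e \<in> J" using characteristic_set_iff[OF inf e J] by blast
    from schmidt_op_in_ideal[OF J this *(1) eo orthonormal_imp_contractions[OF eo] _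
        orthonormal_imp_contractions[OF *(3)] *(4)] eo
    show "X \<in> J" by (subst *(2)) (simp add: orthonormal_def)
  qed
qed (auto simp: characteristic_set_def)

section \<open>Surjectivity of the Calkin correspondence\<close>

text \<open>
  More vectors than the dimension allows are dependent. The family may repeat vectors, in
  which case the combination is the difference of two equal ones.
\<close>

lemma ex_kernel_combination:
  fixes w :: "nat \<Rightarrow> 'a::complex_hilbert"
  assumes "finite T" "card T \<le> n" and w: "\<And>i. i \<le> n \<Longrightarrow> w i \<in> complex_vector.span T"
  shows "\<exists>c. (\<exists>i\<le>n. c i \<noteq> 0) \<and> (\<Sum>i\<le>n. c i *\<^sub>C w i) = 0"
proof (cases "inj_on w {..n}")
  case True
  have "complex_vector.dependent (w ` {..n})"
  proof (rule ccontr)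
    assume "complex_vector.independent (w ` {..n})"
    then have "card (w ` {..n}) \<le> card T"
      using complex_vector.independent_span_bound[OF assms(1)] w by blast
    with card_image[OF True] assms(2) show False by simp
  qed
  then obtain d where "\<exists>v\<in>w ` {..n}. d v \<noteq> 0" "(\<Sum>v\<in>w ` {..n}. d v *\<^sub>C v) = 0"
    using complex_vector.dependent_finite[of "w ` {..n}"] by blast
  then show ?thesis
    by (intro exI[of _ "d \<circ> w"]) (auto simp: sum.reindex[OF True] o_def)
next
  case False
  then obtain i j where ij: "i \<le> n" "j \<le> n" "i \<noteq> j" "w i = w j" by (auto simp: inj_on_def)
  define c where "c k = (if k = i then 1 else if k = j then - 1 else 0 :: complex)" for k
  have "(\<Sum>k\<le>n. c k *\<^sub>C w k) = (\<Sum>k\<in>{i, j}. c k *\<^sub>C w k)"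
    using ij by (intro sum.mono_neutral_right) (auto simp: c_def)
  also have "\<dots> = 0" using ij by (simp add: c_def scaleC_one)
  finally show ?thesis using ij(1) by (intro exI[of _ c]) (auto simp: c_def)
qed

text \<open>
  A minimax argument in place of the inequality \<open>s\<^sub>n(A X B) \<le> \<parallel>A\<parallel> \<parallel>B\<parallel> s\<^sub>n(X)\<close>. In the span
  of \<open>e\<^sub>0, \<dots>, e\<^sub>n\<close> there is \<open>x \<noteq> 0\<close> such that \<open>B x\<close> satisfies the \<open>n\<close> linear conditions of
  being orthogonal to \<open>e\<^sub>0, \<dots>, e\<^bsub>n-1\<^esub>\<close>. On such \<open>x\<close> the left-hand operator is at least
  \<open>\<eta>\<^sub>n \<parallel>x\<parallel>\<close> in norm, the right-hand one at most \<open>\<parallel>A\<parallel> \<xi>\<^sub>n \<parallel>B\<parallel> \<parallel>x\<parallel>\<close>. The sequence \<open>\<eta>\<close> may be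
  constant, so the lemma also shows that the identity does not factor through a diagonal
  operator with entries tending to \<open>0\<close>.
\<close>

lemma diagonal_factor_le:
  fixes e :: "nat \<Rightarrow> 'a::complex_hilbert"
  assumes e: "orthonormal_basis e" and \<xi>: "\<xi> \<in> c0_star"
    and \<eta>: "bounded (range \<eta>)" "decseq \<eta>" "\<And>n. 0 \<le> \<eta> n"
    and A: "A \<in> bounded_operators" and B: "B \<in> bounded_operators"
    and eq: "schmidt_op \<eta> e e = A \<circ> (schmidt_op \<xi> e e \<circ> B)"
  shows "\<exists>C. \<forall>n. \<eta> n \<le> C * \<xi> n"
proof -
  have eo: "orthonormal e UNIV" using e by (simp add: orthonormal_basis_def)
  note ec = orthonormal_imp_contractions[OF eo]
  note bd = c0_star_bounded[OF \<xi>]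
  obtain K where K: "K > 0" "\<And>x. norm (A x) \<le> K * norm x" by (rule bounded_operators_bound[OF A]) auto
  obtain L where L: "L > 0" "\<And>x. norm (B x) \<le> L * norm x" by (rule bounded_operators_bound[OF B]) auto
  interpret B: bounded_linear B by (rule bounded_operators_linear(1)[OF B])
  have "\<eta> n \<le> K * L * \<xi> n" for n
  proof -
    \<comment> \<open>The projection of \<open>B e\<^sub>i\<close> to the span of \<open>e\<^sub>0, \<dots>, e\<^bsub>n-1\<^esub>\<close>: a linear relation between the \<open>n + 1\<close> projections
      gives \<open>x\<close> with \<open>B x\<close> orthogonal to that span.\<close>
    define w where "w i = (\<Sum>j<n. cinner (B (e i)) (e j) *\<^sub>C e j)" for i
    have en: "orthonormal e {..<n}" "orthonormal e {..n}" using eo by (auto intro: orthonormal_subset)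
    have "w i \<in> complex_vector.span (e ` {..<n})" for i
      unfolding w_def
      by (intro complex_vector.span_sum complex_vector.span_scale complex_vector.span_base imageI)
    moreover have "card (e ` {..<n}) \<le> n" using card_image_le[of "{..<n}" e] by simp
    ultimately obtain c i where c: "i \<le> n" "c i \<noteq> 0" "(\<Sum>i\<le>n. c i *\<^sub>C w i) = 0"
      using ex_kernel_combination[of "e ` {..<n}" n w] by blast
    define x where "x = (\<Sum>i\<le>n. c i *\<^sub>C e i)"
    have x_e: "cinner x (e k) = (if k \<le> n then c k else 0)" for k
    proof (cases "k \<le> n")
      case True
      then show ?thesis
        unfolding x_def using cinner_sum_orthogonal[OF orthonormal_imp_contractions[OF en(2)], of k c] eo
        by (simp add: orthonormal_def)
    next
      case False
      then show ?thesis unfolding x_def cinner.sum_left cinner_scaleC_left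
        using eo by (auto simp: orthonormal_def intro!: sum.neutral)
    qed
    have norm_x: "(norm x)\<^sup>2 = (\<Sum>i\<le>n. (cmod (c i))\<^sup>2)"
      unfolding x_def using norm_sum_orthogonal[OF orthonormal_imp_contractions[OF en(2)], of c] eo
      by (simp add: orthonormal_def)
    have "x \<noteq> 0" using x_e[of i] c(1,2) by auto
    have Bx: "cinner (B x) (e j) = 0" if "j < n" for j
    proof -
      have "cinner (B (e i)) (e j) = cinner (w i) (e j)" for i
        unfolding w_def using that eo
          cinner_sum_orthogonal[OF orthonormal_imp_contractions[OF en(1)], of j "\<lambda>j. cinner (B (e i)) (e j)"]
        by (simp add: orthonormal_def)
      then have "cinner (B x) (e j) = cinner (\<Sum>i\<le>n. c i *\<^sub>C w i) (e j)"
        by (simp add: x_def B.sum bounded_operators_linear(2)[OF B] cinner.sum_left cinner_scaleC_left)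
      then show ?thesis by (simp add: c(3))
    qed
    \<comment> \<open>Killing the first \<open>n\<close> entries does not change the value at \<open>B x\<close> and lowers the norm to \<open>\<xi> n\<close>.\<close>
    define \<xi>' where "\<xi>' k = (if k < n then 0 else \<xi> k)" for k
    have \<xi>': "\<bar>\<xi>' k\<bar> \<le> \<xi> n" for k
      using c0_star_nonneg[OF \<xi>] c0_star_antimono[OF \<xi>, of n k] by (auto simp: \<xi>'_def)
    have "schmidt_op \<xi> e e (B x) = schmidt_op \<xi>' e e (B x)"
      unfolding schmidt_op_def by (intro suminf_cong) (simp add: \<xi>'_def Bx)
    moreover have "bounded (range \<xi>')" using \<xi>' by (auto simp: bounded_iff)
    ultimately have up: "norm (schmidt_op \<xi> e e (B x)) \<le> \<xi> n * norm (B x)"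
      using norm_schmidt_op_le[OF _ ec ec \<xi>'] by simp
    have "schmidt_op \<eta> e e x = (\<Sum>k\<le>n. (complex_of_real (\<eta> k) * c k) *\<^sub>C e k)"
      unfolding schmidt_op_def x_e by (subst suminf_finite[of "{..n}"]) (auto intro!: sum.cong)
    then have "(norm (schmidt_op \<eta> e e x))\<^sup>2 = (\<Sum>k\<le>n. (\<eta> k)\<^sup>2 * (cmod (c k))\<^sup>2)"
      using norm_sum_orthogonal[OF orthonormal_imp_contractions[OF en(2)], of "\<lambda>k. complex_of_real (\<eta> k) * c k"] eo
      by (simp add: orthonormal_def norm_mult power_mult_distrib)
    also have "\<dots> \<ge> (\<Sum>k\<le>n. (\<eta> n)\<^sup>2 * (cmod (c k))\<^sup>2)"
      using \<eta>(2,3) by (intro sum_mono mult_right_mono power_mono) (auto simp: decseq_def)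
    finally have "(\<eta> n * norm x)\<^sup>2 \<le> (norm (schmidt_op \<eta> e e x))\<^sup>2"
      by (simp add: power_mult_distrib norm_x sum_distrib_left)
    then have "\<eta> n * norm x \<le> norm (schmidt_op \<eta> e e x)" by (rule power2_le_imp_le) simp
    also have "\<dots> \<le> K * norm (schmidt_op \<xi> e e (B x))" using K(2) by (simp add: eq)
    also have "\<dots> \<le> K * (\<xi> n * (L * norm x))"
      using up L(2)[of x] K(1) c0_star_nonneg[OF \<xi>, of n]
      by (intro mult_left_mono) (auto intro: order_trans mult_left_mono)
    finally have "\<eta> n * norm x \<le> (K * L * \<xi> n) * norm x" by (simp add: mult_ac)
    then show ?thesis using \<open>x \<noteq> 0\<close> by simp
  qed
  then show ?thesis by blast
qed

definition calkin_ideal :: "(nat \<Rightarrow> 'a::complex_hilbert) \<Rightarrow> (nat \<Rightarrow> real) set \<Rightarrow> ('a \<Rightarrow> 'a) set" where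
  "calkin_ideal e \<Sigma> =
     {A \<circ> (schmidt_op \<xi> e e \<circ> B) | A \<xi> B. A \<in> bounded_operators \<and> \<xi> \<in> \<Sigma> \<and> B \<in> bounded_operators}"

text \<open>
  Both summands factor through the same diagonal operator, that of \<open>\<zeta> = \<xi> + \<eta>\<close>. Two copies
  of it placed side by side form the diagonal operator of the ampliation of \<open>\<zeta>\<close>, with the
  even and the odd basis vectors carrying one copy each. So the sum factors through that
  ampliation.
\<close>

lemma calkin_ideal_add:
  fixes e :: "nat \<Rightarrow> 'a::complex_hilbert"
  assumes e: "orthonormal_basis e" and sub: "\<Sigma> \<subseteq> c0_star"
    and add: "\<And>\<xi> \<eta>. \<xi> \<in> \<Sigma> \<Longrightarrow> \<eta> \<in> \<Sigma> \<Longrightarrow> (\<lambda>n. \<xi> n + \<eta> n) \<in> \<Sigma>"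
    and dup: "\<And>\<xi>. \<xi> \<in> \<Sigma> \<Longrightarrow> (\<lambda>n. \<xi> (n div 2)) \<in> \<Sigma>"
    and X: "X \<in> calkin_ideal e \<Sigma>" and Y: "Y \<in> calkin_ideal e \<Sigma>"
  shows "(\<lambda>x. X x + Y x) \<in> calkin_ideal e \<Sigma>"
proof -
  have eo: "orthonormal e UNIV" using e by (simp add: orthonormal_basis_def)
  note ec = orthonormal_imp_contractions[OF eo]
  obtain A \<xi> B where X: "X = A \<circ> (schmidt_op \<xi> e e \<circ> B)" "A \<in> bounded_operators" "\<xi> \<in> \<Sigma>" "B \<in> bounded_operators"
    using X unfolding calkin_ideal_def by blast
  obtain A' \<eta> B' where Y: "Y = A' \<circ> (schmidt_op \<eta> e e \<circ> B')" "A' \<in> bounded_operators" "\<eta> \<in> \<Sigma>" "B' \<in> bounded_operators"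
    using Y unfolding calkin_ideal_def by blast
  define \<zeta> where "\<zeta> n = \<xi> n + \<eta> n" for n
  have \<zeta>: "\<zeta> \<in> \<Sigma>" unfolding \<zeta>_def using add X(3) Y(3) by blast
  have c0: "\<xi> \<in> c0_star" "\<eta> \<in> c0_star" "\<zeta> \<in> c0_star" using sub X(3) Y(3) \<zeta> by auto
  define D where "D = schmidt_op (\<lambda>n. \<zeta> (n div 2)) e e"
  \<comment> \<open>\<open>W 0\<close> and \<open>W 1\<close> are the isometries onto the closed spans of the even and the odd basis vectors, \<open>V 0\<close> and
    \<open>V 1\<close> their adjoints.\<close>
  define W where "W i = schmidt_op (\<lambda>_. 1) e (\<lambda>n. e (2 * n + i))" for i :: nat
  define V where "V i = schmidt_op (\<lambda>_. 1) (\<lambda>n. e (2 * n + i)) e" for i :: nat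
  have one: "bounded (range (\<lambda>_::nat. 1 :: real))" by simp
  have fo: "orthonormal (\<lambda>n. e (2 * n + i)) UNIV" for i using eo by (auto simp: orthonormal_def)
  note fc = orthonormal_imp_contractions[OF fo]
  have bd_dup: "bounded (range (\<lambda>n. \<zeta> (n div 2)))"
    using dup[OF \<zeta>] sub c0_star_bounded by blast
  have W: "W i \<in> bounded_operators" and V: "V i \<in> bounded_operators" for i
    unfolding W_def V_def by (rule schmidt_op_bounded[OF one]; rule ec fc)+
  have D: "D \<in> bounded_operators" unfolding D_def by (rule schmidt_op_bounded[OF bd_dup ec ec])
  have Z: "schmidt_op \<zeta> e e \<in> bounded_operators" by (rule schmidt_op_bounded[OF c0_star_bounded[OF c0(3)] ec ec])
  have WV: "V i \<circ> (D \<circ> W j) = (if i = j then schmidt_op \<zeta> e e else (\<lambda>x. 0))"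
    if "i < 2" "j < 2" for i j
  proof (rule bounded_operators_eqI[OF e])
    show "V i \<circ> (D \<circ> W j) \<in> bounded_operators" by (intro bounded_operators_compose W V D)
    show "(if i = j then schmidt_op \<zeta> e e else (\<lambda>x. 0)) \<in> bounded_operators"
      using Z by (auto simp: bounded_operators_def)
    fix n
    have e1: "norm (e k) = 1" for k using eo by (simp add: orthonormal_def)
    have "W j (e n) = e (2 * n + j)"
      unfolding W_def schmidt_op_basis[OF one ec fc] by (simp add: e1 scaleC_one)
    moreover have "D (e (2 * n + j)) = complex_of_real (\<zeta> n) *\<^sub>C e (2 * n + j)"
      unfolding D_def schmidt_op_basis[OF bd_dup ec ec] using that by (simp add: e1)
    moreover have "V j (e (2 * n + j)) = e n"
      using schmidt_op_basis[OF one fc ec, of j n] by (simp add: V_def e1 scaleC_one)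
    moreover have "V i (e (2 * n + j)) = 0" if "i \<noteq> j"
      unfolding V_def
    proof (rule schmidt_op_eq_0)
      fix m
      have "2 * n + j \<noteq> 2 * m + i" using that \<open>i < 2\<close> \<open>j < 2\<close> by presburger
      then show "cinner (e (2 * n + j)) (e (2 * m + i)) = 0" using eo by (auto simp: orthonormal_def)
    qed
    moreover have "schmidt_op \<zeta> e e (e n) = complex_of_real (\<zeta> n) *\<^sub>C e n"
      unfolding schmidt_op_basis[OF c0_star_bounded[OF c0(3)] ec ec] by (simp add: e1)
    ultimately show "(V i \<circ> (D \<circ> W j)) (e n) = (if i = j then schmidt_op \<zeta> e e else (\<lambda>x. 0)) (e n)"
      by (auto simp: bounded_operators_linear(2)[OF V])
  qed
  \<comment> \<open>The quotient is \<open>0\<close> where \<open>\<zeta>\<close> vanishes, which is correct since \<open>\<alpha>\<close> vanishes there as well.\<close>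
  have split: "\<exists>Q \<in> bounded_operators. schmidt_op \<alpha> e e = schmidt_op \<zeta> e e \<circ> Q"
    if \<alpha>: "\<And>n. 0 \<le> \<alpha> n \<and> \<alpha> n \<le> \<zeta> n" for \<alpha>
  proof
    have "\<bar>\<alpha> n / \<zeta> n\<bar> \<le> 1" for n
      using \<alpha>[of n] by (cases "\<zeta> n = 0") (auto simp: divide_le_eq)
    then have q: "bounded (range (\<lambda>n. \<alpha> n / \<zeta> n))" by (auto simp: bounded_iff)
    show "schmidt_op (\<lambda>n. \<alpha> n / \<zeta> n) e e \<in> bounded_operators" by (rule schmidt_op_bounded[OF q ec ec])
    have "\<zeta> n * (\<alpha> n / \<zeta> n) * (norm (e n))\<^sup>2 = \<alpha> n" for n
      using \<alpha>[of n] eo by (cases "\<zeta> n = 0") (auto simp: orthonormal_def)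
    then show "schmidt_op \<alpha> e e = schmidt_op \<zeta> e e \<circ> schmidt_op (\<lambda>n. \<alpha> n / \<zeta> n) e e"
      using schmidt_op_compose[OF q c0_star_bounded[OF c0(3)] ec ec] by simp
  qed
  obtain Q where Q: "Q \<in> bounded_operators" "schmidt_op \<xi> e e = schmidt_op \<zeta> e e \<circ> Q"
    using split[of \<xi>] c0_star_nonneg[OF c0(1)] c0_star_nonneg[OF c0(2)] by (auto simp: \<zeta>_def)
  obtain R where R: "R \<in> bounded_operators" "schmidt_op \<eta> e e = schmidt_op \<zeta> e e \<circ> R"
    using split[of \<eta>] c0_star_nonneg[OF c0(1)] c0_star_nonneg[OF c0(2)] by (auto simp: \<zeta>_def)
  define M where "M x = A (V 0 x) + A' (V 1 x)" for x
  define N where "N x = W 0 (Q (B x)) + W 1 (R (B' x))" for x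
  have M: "M \<in> bounded_operators"
    unfolding M_def using bounded_operators_add[OF bounded_operators_compose[OF X(2) V] bounded_operators_compose[OF Y(2) V]]
    by simp
  have N: "N \<in> bounded_operators"
    unfolding N_def using bounded_operators_add[OF bounded_operators_compose[OF W bounded_operators_compose[OF Q(1) X(4)]]
        bounded_operators_compose[OF W bounded_operators_compose[OF R(1) Y(4)]]]
    by simp
  have VDW: "V i (D (W j x)) = (if i = j then schmidt_op \<zeta> e e x else 0)" if "i < 2" "j < 2" for i j x
    using fun_cong[OF WV[OF that], of x] by (simp split: if_splits)
  have addD: "Z (x + y) = Z x + Z y" if "Z \<in> bounded_operators" for Z :: "'a \<Rightarrow> 'a" and x y
    using bounded_operators_linear(1)[OF that] linear_simps(1) by blast
  have "X x + Y x = (M \<circ> (D \<circ> N)) x" for x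
    using fun_cong[OF Q(2), of "B x"] fun_cong[OF R(2), of "B' x"]
    by (simp add: X(1) Y(1) M_def N_def addD[OF D] addD[OF V] VDW)
  then have "(\<lambda>x. X x + Y x) = M \<circ> (D \<circ> N)" by auto
  then show ?thesis
    unfolding calkin_ideal_def D_def using M N dup[OF \<zeta>] by blast
qed

text \<open>
  The half of Calkin's theorem that produces an ideal from a characteristic set. Invariance
  under doubling already gives invariance under every ampliation, since a decreasing
  sequence repeated \<open>m\<close> times lies below its repetition \<open>2\<^sup>k\<close> times for \<open>2\<^sup>k \<ge> m\<close>. The
  singular values of \<open>A \<circ> diag \<xi> \<circ> B\<close> are \<open>O(\<xi>)\<close> and hence stay in the set.
\<close>

theorem Calkin_surjective:
  fixes e :: "nat \<Rightarrow> 'a::complex_hilbert"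
  assumes inf: "infinite_dimensional TYPE('a)" and sep: "separable TYPE('a)"
    and sub: "\<Sigma> \<subseteq> c0_star" and zero: "(\<lambda>n. 0) \<in> \<Sigma>"
    and add: "\<And>\<xi> \<eta>. \<xi> \<in> \<Sigma> \<Longrightarrow> \<eta> \<in> \<Sigma> \<Longrightarrow> (\<lambda>n. \<xi> n + \<eta> n) \<in> \<Sigma>"
    and hered: "\<And>\<xi> \<eta> C. \<xi> \<in> \<Sigma> \<Longrightarrow> \<eta> \<in> c0_star \<Longrightarrow> (\<And>n. \<eta> n \<le> C * \<xi> n) \<Longrightarrow> \<eta> \<in> \<Sigma>"
    and dup: "\<And>\<xi>. \<xi> \<in> \<Sigma> \<Longrightarrow> (\<lambda>n. \<xi> (n div 2)) \<in> \<Sigma>"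
  shows "\<exists>K :: ('a \<Rightarrow> 'a) set. operator_ideal K \<and> characteristic_set K = \<Sigma>"
proof -
  obtain e :: "nat \<Rightarrow> 'a" where e: "orthonormal_basis e" using ex_orthonormal_basis[OF inf sep] by blast
  have eo: "orthonormal e UNIV" using e by (simp add: orthonormal_basis_def)
  note ec = orthonormal_imp_contractions[OF eo]
  have diag: "schmidt_op \<xi> e e \<in> bounded_operators" if "\<xi> \<in> c0_star" for \<xi>
    using schmidt_op_bounded[OF c0_star_bounded[OF that] ec ec] .
  have sub_bd: "calkin_ideal e \<Sigma> \<subseteq> bounded_operators"
    unfolding calkin_ideal_def using sub by (auto intro!: bounded_operators_compose diag)
  have id: "(\<lambda>x. x) \<notin> calkin_ideal e \<Sigma>"
  proof
    assume "(\<lambda>x. x) \<in> calkin_ideal e \<Sigma>"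
    then obtain A \<xi> B where *: "(\<lambda>x. x) = A \<circ> (schmidt_op \<xi> e e \<circ> B)" "A \<in> bounded_operators" "\<xi> \<in> \<Sigma>" "B \<in> bounded_operators"
      unfolding calkin_ideal_def by blast
    have \<xi>: "\<xi> \<in> c0_star" using sub *(3) by blast
    have "schmidt_op (\<lambda>_. 1) e e = (\<lambda>x. x)"
      using orthonormal_basis_expansion[OF e] by (intro ext) (simp add: schmidt_op_def sums_iff)
    then have "\<exists>C. \<forall>n::nat. 1 \<le> C * \<xi> n"
      using *(1) by (intro diagonal_factor_le[OF e \<xi> _ _ _ *(2,4), where \<eta>="\<lambda>_. 1"]) (auto simp: decseq_def)
    then obtain C where "\<And>n. 1 \<le> C * \<xi> n" by blast
    with LIMSEQ_le_const[OF tendsto_mult_left[OF c0_star_lim[OF \<xi>], of C], of 1] show False by auto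
  qed
  have I: "operator_ideal (calkin_ideal e \<Sigma>)"
    unfolding operator_ideal_def
  proof (intro conjI ballI)
    show "calkin_ideal e \<Sigma> \<noteq> bounded_operators" using id bounded_operators_id by blast
    have "(\<lambda>x. 0) = (\<lambda>x. x) \<circ> (schmidt_op (\<lambda>n. 0) e e \<circ> (\<lambda>x. x))" by (auto simp: schmidt_op_def)
    then show "(\<lambda>x. 0) \<in> calkin_ideal e \<Sigma>"
      unfolding calkin_ideal_def using zero bounded_operators_id by blast
    fix X assume X: "X \<in> calkin_ideal e \<Sigma>"
    show "(\<lambda>x. X x + Y x) \<in> calkin_ideal e \<Sigma>" if "Y \<in> calkin_ideal e \<Sigma>" for Y
      by (rule calkin_ideal_add[OF e sub add dup X that])
    fix T :: "'a \<Rightarrow> 'a" assume T: "T \<in> bounded_operators"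
    obtain A \<xi> B where *: "X = A \<circ> (schmidt_op \<xi> e e \<circ> B)" "A \<in> bounded_operators" "\<xi> \<in> \<Sigma>" "B \<in> bounded_operators"
      using X unfolding calkin_ideal_def by blast
    have "T \<circ> X = (T \<circ> A) \<circ> (schmidt_op \<xi> e e \<circ> B)" "X \<circ> T = A \<circ> (schmidt_op \<xi> e e \<circ> (B \<circ> T))"
      by (auto simp: *(1))
    then show "T \<circ> X \<in> calkin_ideal e \<Sigma>" "X \<circ> T \<in> calkin_ideal e \<Sigma>"
      unfolding calkin_ideal_def using *(2-4) T bounded_operators_compose by blast+
  qed (use sub_bd in blast)
  have "characteristic_set (calkin_ideal e \<Sigma>) = \<Sigma>"
  proof (intro set_eqI iffI)
    fix \<xi> assume "\<xi> \<in> \<Sigma>"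
    moreover have "schmidt_op \<xi> e e = (\<lambda>x. x) \<circ> (schmidt_op \<xi> e e \<circ> (\<lambda>x. x))" by auto
    ultimately have "schmidt_op \<xi> e e \<in> calkin_ideal e \<Sigma>"
      unfolding calkin_ideal_def using bounded_operators_id by blast
    then show "\<xi> \<in> characteristic_set (calkin_ideal e \<Sigma>)"
      using characteristic_set_iff[OF inf e I] sub \<open>\<xi> \<in> \<Sigma>\<close> by blast
  next
    fix \<eta> assume "\<eta> \<in> characteristic_set (calkin_ideal e \<Sigma>)"
    then have \<eta>: "\<eta> \<in> c0_star" "schmidt_op \<eta> e e \<in> calkin_ideal e \<Sigma>"
      using characteristic_set_iff[OF inf e I] by blast+
    then obtain A \<xi> B where *: "schmidt_op \<eta> e e = A \<circ> (schmidt_op \<xi> e e \<circ> B)" "A \<in> bounded_operators" "\<xi> \<in> \<Sigma>" "B \<in> bounded_operators"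
      unfolding calkin_ideal_def by blast
    have "\<xi> \<in> c0_star" using sub *(3) by blast
    from diagonal_factor_le[OF e this c0_star_bounded[OF \<eta>(1)] _ _ *(2,4,1)] \<eta>(1)
    obtain C where "\<And>n. \<eta> n \<le> C * \<xi> n" by (auto simp: c0_star_def)
    with hered[OF *(3) \<eta>(1)] show "\<eta> \<in> \<Sigma>" by blast
  qed
  with I show ?thesis by blast
qed

section \<open>Sequences of slow growth\<close>

text \<open>
  Going from \<open>k\<close> to \<open>k\<^sup>2\<close> doubles \<open>log k\<close>, so the tail beyond \<open>k\<close> is a fixed proportion of
  the harmonic sum \<open>H\<close> up to \<open>k\<^sup>2\<close>. Cutting the tail into blocks of length \<open>k\<close>, the \<open>j\<close>-th
  of which lies between \<open>1/(j+1)\<close> and \<open>1/j\<close>, puts the tail between \<open>H\<^sub>k - 1\<close> and \<open>H\<^sub>k\<close>; and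
  \<open>H\<^sub>k \<ge> H\<^sub>2 = 3/2\<close>.
\<close>

lemma sum_inverse_square_le:
  fixes k :: nat
  assumes "k \<ge> 2"
  shows "(\<Sum>m=1..k\<^sup>2. 1 / real m) \<le> 6 * (\<Sum>m=k+1..k\<^sup>2. 1 / real m)"
proof -
  define H where "H n = (\<Sum>m=1..n. 1 / real m)" for n :: nat
  define G where "G n = (\<Sum>m=k+1..n. 1 / real m)" for n :: nat
  have split: "H n = H k + G n" if "n \<ge> k" for n
    unfolding H_def G_def using that sum.ub_add_nat[of 1 k "\<lambda>m. 1 / real m" "n - k"] assms by simp
  have block: "1 / real (j + 1) \<le> (\<Sum>m=j*k+1..(j+1)*k. 1 / real m) \<and>
      (\<Sum>m=j*k+1..(j+1)*k. 1 / real m) \<le> 1 / real j" if "j \<ge> 1" for j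
  proof -
    have k: "real k > 0" using assms by simp
    have card: "real (card {j*k+1..(j+1)*k}) = real k" by simp
    have "(\<Sum>m=j*k+1..(j+1)*k. 1 / real m) \<ge> of_nat (card {j*k+1..(j+1)*k}) * (1 / real ((j+1)*k))"
      by (rule sum_bounded_below) (auto simp: frac_le simp del: of_nat_mult of_nat_add intro!: divide_left_mono)
    moreover have "(\<Sum>m=j*k+1..(j+1)*k. 1 / real m) \<le> of_nat (card {j*k+1..(j+1)*k}) * (1 / real (j*k))"
      using that k by (intro sum_bounded_above divide_left_mono) (auto simp del: of_nat_mult of_nat_add)
    moreover have "real k * (1 / real ((j+1)*k)) = 1 / real (j + 1)" "real k * (1 / real (j*k)) = 1 / real j"
      unfolding of_nat_mult using k by (simp_all del: of_nat_Suc of_nat_add)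
    ultimately show ?thesis unfolding card by simp
  qed
  have blocks: "(\<Sum>j=1..i. 1 / real (j + 1)) \<le> G ((i + 1) * k) \<and> G ((i + 1) * k) \<le> H i" for i
  proof (induction i)
    case 0
    then show ?case by (simp add: G_def H_def)
  next
    case (Suc i)
    have "G ((Suc i + 1) * k) = G ((i + 1) * k) + (\<Sum>m=Suc i*k+1..(Suc i+1)*k. 1 / real m)"
      unfolding G_def using sum.ub_add_nat[of "k+1" "(i+1)*k" "\<lambda>m. 1 / real m" k]
      by (simp add: algebra_simps)
    with Suc block[of "Suc i"] show ?case by (simp add: H_def)
  qed
  have kk: "(k - 1 + 1) * k = k\<^sup>2" using assms by (simp add: power2_eq_square)
  have "(\<Sum>j=1..k-1. 1 / real (j + 1)) = H k - 1"
  proof -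
    have "(\<Sum>j=1..k-1. 1 / real (j + 1)) = (\<Sum>j=2..k. 1 / real j)"
      using assms by (intro sum.reindex_bij_witness[of _ "\<lambda>j. j - 1" "\<lambda>j. j + 1"]) auto
    also have "\<dots> = H k - 1" unfolding H_def using assms sum.atLeast_Suc_atMost[of 1 k "\<lambda>j. 1 / real j"]
      by (simp add: numeral_2_eq_2)
    finally show ?thesis .
  qed
  then have low: "H k - 1 \<le> G (k\<^sup>2)" using blocks[of "k - 1"] unfolding kk by simp
  have "H (k - 1) \<le> H k" unfolding H_def by (intro sum_mono2) auto
  then have up: "G (k\<^sup>2) \<le> H k" using blocks[of "k - 1"] unfolding kk by linarith
  have "H 2 \<le> H k" unfolding H_def using assms by (intro sum_mono2) auto
  moreover have "H 2 = 3 / 2" by (simp add: H_def numeral_2_eq_2)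
  ultimately have "H k \<ge> 3 / 2" by simp
  moreover have "H (k\<^sup>2) = H k + G (k\<^sup>2)" using assms by (intro split) (simp add: power2_eq_square)
  ultimately have "H (k\<^sup>2) \<le> 6 * G (k\<^sup>2)" using low up by simp
  then show ?thesis by (simp add: H_def G_def)
qed

text \<open>
  The heart of the matter. Compare the two sides at \<open>n = k\<^sup>2\<close>: keeping only the terms beyond
  \<open>k\<close>, the left-hand side is at least \<open>T\<^sub>k\<close> times the harmonic sum from \<open>k + 1\<close> to \<open>k\<^sup>2\<close>,
  while the right-hand side is at most \<open>\<bar>C\<bar> S\<^sub>m\<close>, \<open>m = k\<^sup>2\<close>, times the full harmonic sum.
  The harmonic sums are comparable, so they cancel at the price of replacing the index \<open>k\<close>
  by its square.
\<close>

lemma weighted_sums_comparison: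
  fixes S T :: "nat \<Rightarrow> real"
  assumes S: "mono S" "\<And>n. 0 \<le> S n" and T: "mono T" "\<And>n. 0 \<le> T n"
    and le: "\<And>n. (\<Sum>m=1..n. T m / real m) \<le> C * (\<Sum>m=1..n. S m / real m)"
  shows "\<exists>D\<ge>0. \<forall>k\<ge>1. T k \<le> D * S (k\<^sup>2)"
proof (intro exI[of _ "6 * \<bar>C\<bar>"] conjI allI impI)
  fix k :: nat assume k: "k \<ge> 1"
  show "T k \<le> 6 * \<bar>C\<bar> * S (k\<^sup>2)"
  proof (cases "k = 1")
    case True
    have "T 1 \<le> C * S 1" using le[of 1] by simp
    also have "\<dots> \<le> 6 * \<bar>C\<bar> * S 1" using S(2)[of 1] by (intro mult_right_mono) auto
    finally show ?thesis by (simp add: True)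
  next
    case False
    with k have k2: "k \<ge> 2" by simp
    define G where "G = (\<Sum>m=k+1..k\<^sup>2. 1 / real m)"
    have sq: "k + 1 \<le> k\<^sup>2" using k2 mult_le_mono1[OF k2, of k] unfolding power2_eq_square by linarith
    have G: "G > 0" unfolding G_def using sq by (intro sum_pos) auto
    have "T k * G = (\<Sum>m=k+1..k\<^sup>2. T k / real m)" by (simp add: G_def sum_distrib_left)
    also have "\<dots> \<le> (\<Sum>m=k+1..k\<^sup>2. T m / real m)"
      by (intro sum_mono divide_right_mono monoD[OF T(1)]) auto
    also have "\<dots> \<le> (\<Sum>m=1..k\<^sup>2. T m / real m)"
      using T(2) by (intro sum_mono2) auto
    also have "\<dots> \<le> C * (\<Sum>m=1..k\<^sup>2. S m / real m)" by (rule le)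
    also have "\<dots> \<le> \<bar>C\<bar> * (\<Sum>m=1..k\<^sup>2. S m / real m)"
      using S(2) by (intro mult_right_mono sum_nonneg) auto
    also have "\<dots> \<le> \<bar>C\<bar> * (\<Sum>m=1..k\<^sup>2. S (k\<^sup>2) / real m)"
      by (intro mult_left_mono sum_mono divide_right_mono monoD[OF S(1)]) auto
    also have "\<dots> = \<bar>C\<bar> * S (k\<^sup>2) * (\<Sum>m=1..k\<^sup>2. 1 / real m)" by (simp add: sum_distrib_left mult.assoc)
    also have "\<dots> \<le> \<bar>C\<bar> * S (k\<^sup>2) * (6 * G)"
      unfolding G_def using S(2) by (intro mult_left_mono sum_inverse_square_le k2) auto
    finally have "T k * G \<le> (6 * \<bar>C\<bar> * S (k\<^sup>2)) * G" by (simp add: mult_ac)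
    then show ?thesis using G by simp
  qed
qed simp

text \<open>
  If \<open>S\<close> grows so slowly that passing to the squared index costs a constant factor only,
  then the square in the comparison is harmless: for \<open>k\<^sup>2 \<le> n < (k + 1)\<^sup>2\<close> and \<open>k \<ge> 2\<close> one
  has \<open>n \<le> k\<^sup>4\<close>, so that two applications of the growth condition bring \<open>S\<^sub>n\<close> down to \<open>S\<^sub>k\<close>.
  The remaining \<open>n \<le> 3\<close> are covered by the bound \<open>S\<^sub>n \<le> n S\<^sub>1\<close>.
\<close>

lemma comparison_from_squares:
  fixes S T :: "nat \<Rightarrow> real"
  assumes S: "mono S" and T: "mono T" "\<And>n. 0 \<le> T n"
    and D: "D \<ge> 0" "\<And>k. k \<ge> 1 \<Longrightarrow> S k \<le> D * T (k\<^sup>2)"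
    and K: "K \<ge> 0" "\<And>k. k \<ge> 1 \<Longrightarrow> S (k\<^sup>2) \<le> K * S k"
    and sub: "\<And>n. n \<ge> 1 \<Longrightarrow> S n \<le> real n * S 1"
  shows "\<exists>E. \<forall>n\<ge>1. S n \<le> E * T n"
proof (intro exI[of _ "3 * D + K\<^sup>2 * D"] allI impI)
  fix n :: nat assume n: "n \<ge> 1"
  \<comment> \<open>The integer square root of \<open>n\<close>.\<close>
  define k where "k = (GREATEST k. k\<^sup>2 \<le> n)"
  have bound: "\<And>j. j\<^sup>2 \<le> n \<Longrightarrow> j \<le> n" by (metis le_square le_trans power2_eq_square)
  have k: "k\<^sup>2 \<le> n" unfolding k_def by (rule GreatestI_nat[of _ 0 n]) (use bound in auto)
  have "\<not> (k + 1)\<^sup>2 \<le> n"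
  proof
    assume "(k + 1)\<^sup>2 \<le> n"
    then have "k + 1 \<le> k" unfolding k_def by (rule Greatest_le_nat[of _ _ n]) (use bound in auto)
    then show False by simp
  qed
  then have k1: "n < (k + 1)\<^sup>2" by simp
  have "k \<ge> 1" using k1 n by (cases k) auto
  show "S n \<le> (3 * D + K\<^sup>2 * D) * T n"
  proof (cases "k = 1")
    case True
    then have "n \<le> 3" using k1 by (simp add: power2_eq_square)
    have S1: "S 1 \<le> D * T 1" using D(2)[of 1] by simp
    have "S n \<le> real n * S 1" by (rule sub[OF n])
    also have "\<dots> \<le> real n * (D * T 1)" using S1 by (intro mult_left_mono) auto
    also have "\<dots> \<le> 3 * (D * T n)"
      using \<open>n \<le> 3\<close> D(1) T(2) monoD[OF T(1) n] by (intro mult_mono mult_left_mono mult_nonneg_nonneg) auto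
    also have "\<dots> \<le> (3 * D + K\<^sup>2 * D) * T n" using D(1) T(2)[of n] by (simp add: algebra_simps)
    finally show ?thesis .
  next
    case False
    with \<open>k \<ge> 1\<close> have k2: "k \<ge> 2" by simp
    have "k + 1 \<le> k\<^sup>2" using k2 mult_le_mono1[OF k2, of k] unfolding power2_eq_square by linarith
    then have "(k + 1)\<^sup>2 \<le> (k\<^sup>2)\<^sup>2" by (rule power_mono) simp
    then have "S n \<le> S ((k\<^sup>2)\<^sup>2)" using k1 by (intro monoD[OF S]) simp
    also have "\<dots> \<le> K * S (k\<^sup>2)" using \<open>k \<ge> 1\<close> by (intro K(2)) simp
    also have "\<dots> \<le> K * (K * S k)" using K \<open>k \<ge> 1\<close> by (intro mult_left_mono) auto
    also have "\<dots> \<le> K * (K * (D * T (k\<^sup>2)))" using K(1) D(2) \<open>k \<ge> 1\<close> by (intro mult_left_mono) auto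
    also have "\<dots> \<le> K * (K * (D * T n))" using K(1) D(1) monoD[OF T(1) k] by (intro mult_left_mono) auto
    also have "\<dots> \<le> (3 * D + K\<^sup>2 * D) * T n" using D(1) T(2)[of n] by (simp add: algebra_simps power2_eq_square)
    finally show ?thesis .
  qed
qed

section \<open>Arithmetic means of sequences\<close>

lemma arith_mean_times: "real (n + 1) * arith_mean \<xi> n = (\<Sum>j\<le>n. \<xi> j)"
  by (simp add: arith_mean_def)

lemma arith_mean_nonneg: "(\<And>n. 0 \<le> \<xi> n) \<Longrightarrow> 0 \<le> arith_mean \<xi> n"
  by (simp add: arith_mean_def sum_nonneg)

lemma le_arith_mean:
  assumes "decseq \<xi>" shows "\<xi> n \<le> arith_mean \<xi> n"
proof -
  have "real (n + 1) * \<xi> n = (\<Sum>j\<le>n. \<xi> n)" by simp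
  also have "\<dots> \<le> (\<Sum>j\<le>n. \<xi> j)" using assms by (intro sum_mono) (auto simp: decseq_def)
  finally show ?thesis by (simp add: arith_mean_def field_simps)
qed

text \<open>
  The mean decreases because each new entry lies below the mean of the earlier ones. It
  tends to \<open>0\<close> by the usual splitting of the sum at an index beyond which the entries are
  below \<open>\<epsilon>/2\<close>.
\<close>

lemma arith_mean_c0_star:
  assumes \<xi>: "\<xi> \<in> c0_star" shows "arith_mean \<xi> \<in> c0_star"
proof -
  have dec: "decseq \<xi>" and pos: "\<And>n. 0 \<le> \<xi> n" and lim: "\<xi> \<longlonglongrightarrow> 0" using \<xi> by (auto simp: c0_star_def)
  have "arith_mean \<xi> (Suc n) \<le> arith_mean \<xi> n" for n
  proof -
    have "real (n + 1) * \<xi> (Suc n) \<le> real (n + 1) * arith_mean \<xi> n"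
      using le_arith_mean[OF dec, of n] decseqD[OF dec, of n "Suc n"] by (intro mult_left_mono) auto
    moreover have "real (Suc n + 1) * arith_mean \<xi> (Suc n) = real (n + 1) * arith_mean \<xi> n + \<xi> (Suc n)"
      unfolding arith_mean_times by simp
    ultimately have "real (n + 1) * (real (Suc n + 1) * arith_mean \<xi> (Suc n)) \<le> real (n + 1) * (real (Suc n + 1) * arith_mean \<xi> n)"
      by (simp add: algebra_simps)
    then show ?thesis by (simp add: mult_le_cancel_left_pos del: of_nat_Suc)
  qed
  then have "decseq (arith_mean \<xi>)" by (simp add: decseq_Suc_iff)
  moreover have "arith_mean \<xi> \<longlonglongrightarrow> 0"
  proof (rule LIMSEQ_I)
    fix \<epsilon> :: real assume \<epsilon>: "\<epsilon> > 0"
    then obtain N where N: "\<And>n. n \<ge> N \<Longrightarrow> \<xi> n < \<epsilon> / 2"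
      using LIMSEQ_D[OF lim, of "\<epsilon> / 2"] pos by force
    define s where "s = (\<Sum>j<N. \<xi> j)"
    obtain M :: nat where M: "s / (\<epsilon> / 2) < real M" using reals_Archimedean2 by blast
    have "norm (arith_mean \<xi> n - 0) < \<epsilon>" if n: "n \<ge> max N M" for n
    proof -
      have "{..n} = {..<N} \<union> {N..n}" using n by auto
      then have "(\<Sum>j\<le>n. \<xi> j) = s + (\<Sum>j=N..n. \<xi> j)"
        unfolding s_def by (subst sum.union_disjoint[symmetric]) auto
      moreover have "(\<Sum>j=N..n. \<xi> j) \<le> real (card {N..n}) * (\<epsilon> / 2)"
        using N by (intro sum_bounded_above) (auto intro: less_imp_le)
      moreover have "real (card {N..n}) * (\<epsilon> / 2) \<le> real (n + 1) * (\<epsilon> / 2)"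
        using \<epsilon> by (intro mult_right_mono) auto
      moreover have "s < real (n + 1) * (\<epsilon> / 2)"
      proof -
        have "s < real M * (\<epsilon> / 2)" using M \<epsilon> by (simp add: field_simps)
        also have "\<dots> \<le> real (n + 1) * (\<epsilon> / 2)" using n \<epsilon> by (intro mult_right_mono) auto
        finally show ?thesis .
      qed
      ultimately have "real (n + 1) * arith_mean \<xi> n < real (n + 1) * \<epsilon>"
        unfolding arith_mean_times by (simp add: algebra_simps)
      then have "arith_mean \<xi> n < \<epsilon>" by (simp add: mult_less_cancel_left_pos del: of_nat_Suc)
      then show ?thesis using arith_mean_nonneg[of \<xi> n] pos by simp
    qed
    then show "\<exists>N. \<forall>n\<ge>N. norm (arith_mean \<xi> n - 0) < \<epsilon>" by blast
  qed
  ultimately show ?thesis using arith_mean_nonneg pos by (auto simp: c0_star_def)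
qed

lemma arith_mean_power_c0_star: "\<xi> \<in> c0_star \<Longrightarrow> (arith_mean ^^ p) \<xi> \<in> c0_star"
  by (induction p) (auto intro: arith_mean_c0_star)

lemma arith_mean_add: "arith_mean (\<lambda>n. \<xi> n + \<eta> n) n = arith_mean \<xi> n + arith_mean \<eta> n"
  by (simp add: arith_mean_def sum.distrib add_divide_distrib)

lemma arith_mean_le:
  assumes "\<And>n. \<xi> n \<le> C * \<eta> n" shows "arith_mean \<xi> n \<le> C * arith_mean \<eta> n"
proof -
  have "(\<Sum>j\<le>n. \<xi> j) \<le> C * (\<Sum>j\<le>n. \<eta> j)" unfolding sum_distrib_left using assms by (rule sum_mono)
  then show ?thesis by (simp add: arith_mean_def divide_right_mono)
qed

lemma arith_mean_power_le:
  assumes "\<And>n. \<xi> n \<le> \<eta> n" shows "(arith_mean ^^ p) \<xi> n \<le> (arith_mean ^^ p) \<eta> n"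
proof (induction p arbitrary: n)
  case (Suc p)
  then show ?case using arith_mean_le[of "(arith_mean ^^ p) \<xi>" 1 "(arith_mean ^^ p) \<eta>"] by simp
qed (use assms in simp)

text \<open>
  The invariance of means under ampliation: \<open>n \<eta>\<^sub>a(n)\<close> is increasing in \<open>n\<close>, so halving the
  index at most doubles the mean.
\<close>

lemma arith_mean_half_le:
  assumes "\<And>n. 0 \<le> \<xi> n" shows "arith_mean \<xi> (n div 2) \<le> 2 * arith_mean \<xi> n"
proof -
  have "real (n + 1) * arith_mean \<xi> (n div 2) \<le> 2 * real (n div 2 + 1) * arith_mean \<xi> (n div 2)"
    using arith_mean_nonneg[of \<xi> "n div 2"] assms by (intro mult_right_mono) auto
  also have "\<dots> = 2 * (\<Sum>j\<le>n div 2. \<xi> j)" by (simp only: mult.assoc arith_mean_times)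
  also have "\<dots> \<le> 2 * (\<Sum>j\<le>n. \<xi> j)" using assms by (intro mult_left_mono sum_mono2) auto
  also have "\<dots> = real (n + 1) * (2 * arith_mean \<xi> n)" using arith_mean_times[of n \<xi>] by simp
  finally show ?thesis by (simp add: mult_le_cancel_left_pos del: of_nat_Suc)
qed

section \<open>Arithmetic mean ideals\<close>

text \<open>
  For \<open>p \<ge> 1\<close> and the characteristic set of an ideal, this turns out to be the
  characteristic set of the \<open>p\<close>-th iterated arithmetic mean ideal.
\<close>

definition dominated_by_means :: "nat \<Rightarrow> (nat \<Rightarrow> real) set \<Rightarrow> (nat \<Rightarrow> real) set" where
  "dominated_by_means p \<Sigma> =
     {\<xi> \<in> c0_star. \<exists>\<eta>\<in>\<Sigma>. \<exists>C. \<forall>n. \<xi> n \<le> C * (arith_mean ^^ p) \<eta> n}"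

lemma characteristic_set_add:
  fixes I :: "('a::complex_hilbert \<Rightarrow> 'a) set"
  assumes inf: "infinite_dimensional TYPE('a)" and e: "orthonormal_basis (e :: nat \<Rightarrow> 'a)"
    and I: "operator_ideal I" and \<xi>: "\<xi> \<in> characteristic_set I" and \<eta>: "\<eta> \<in> characteristic_set I"
  shows "(\<lambda>n. \<xi> n + \<eta> n) \<in> characteristic_set I"
proof -
  note iff = characteristic_set_iff[OF inf e I]
  note ec = orthonormal_basis_contractions[OF e]
  have c0: "\<xi> \<in> c0_star" "\<eta> \<in> c0_star" and mem: "schmidt_op \<xi> e e \<in> I" "schmidt_op \<eta> e e \<in> I"
    using \<xi> \<eta> iff by auto
  have "schmidt_op (\<lambda>n. \<xi> n + \<eta> n) e e = (\<lambda>x. schmidt_op \<xi> e e x + schmidt_op \<eta> e e x)"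
  proof
    fix x
    show "schmidt_op (\<lambda>n. \<xi> n + \<eta> n) e e x = schmidt_op \<xi> e e x + schmidt_op \<eta> e e x"
      unfolding schmidt_op_def
      by (subst suminf_add[OF summable_schmidt[OF c0_star_bounded[OF c0(1)] ec ec]
            summable_schmidt[OF c0_star_bounded[OF c0(2)] ec ec]])
        (simp add: scaleC_add_left distrib_right)
  qed
  also have "\<dots> \<in> I" using mem I unfolding operator_ideal_def by blast
  finally have "schmidt_op (\<lambda>n. \<xi> n + \<eta> n) e e \<in> I" .
  moreover have "(\<lambda>n. \<xi> n + \<eta> n) \<in> c0_star"
    using c0 tendsto_add[OF c0_star_lim[OF c0(1)] c0_star_lim[OF c0(2)]]
    by (auto simp: c0_star_def decseq_def intro: add_mono)
  ultimately show ?thesis using iff by blast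
qed

lemma ideal_eq_iff:
  fixes I J :: "('a::complex_hilbert \<Rightarrow> 'a) set"
  assumes "infinite_dimensional TYPE('a)" "separable TYPE('a)" "operator_ideal I" "operator_ideal J"
  shows "I = J \<longleftrightarrow> characteristic_set I = characteristic_set J"
  using ideal_subset_iff[OF assms] ideal_subset_iff[OF assms(1,2,4,3)] by auto

text \<open>
  The sequences dominated by means form a characteristic set, so by Calkin's theorem the
  defining description of the arithmetic mean ideal denotes a unique ideal.
\<close>

lemma arith_mean_ideal:
  fixes I :: "('a::complex_hilbert \<Rightarrow> 'a) set"
  assumes inf: "infinite_dimensional TYPE('a)" and sep: "separable TYPE('a)" and I: "operator_ideal I"
  shows "operator_ideal (arith_mean_ideal I)"
    and "characteristic_set (arith_mean_ideal I) =
      {\<xi> \<in> c0_star. \<exists>\<eta>\<in>characteristic_set I. \<exists>C. \<forall>n. \<xi> n \<le> C * arith_mean \<eta> n}" (is "_ = ?\<Sigma>")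
proof -
  obtain e :: "nat \<Rightarrow> 'a" where e: "orthonormal_basis e" using ex_orthonormal_basis[OF inf sep] by blast
  note iff = characteristic_set_iff[OF inf e I]
  have \<Sigma>I: "\<eta> \<in> c0_star" if "\<eta> \<in> characteristic_set I" for \<eta> using iff that by blast
  have am: "0 \<le> arith_mean \<eta> n" if "\<eta> \<in> characteristic_set I" for \<eta> n
    using c0_star_nonneg[OF \<Sigma>I[OF that]] arith_mean_nonneg by blast
  have "\<exists>K :: ('a \<Rightarrow> 'a) set. operator_ideal K \<and> characteristic_set K = ?\<Sigma>"
  proof (rule Calkin_surjective[OF inf sep])
    show "?\<Sigma> \<subseteq> c0_star" by blast
    have zero: "(\<lambda>n. 0) \<in> c0_star" by (simp add: c0_star_def decseq_def)
    have "schmidt_op (\<lambda>n. 0) e e = (\<lambda>x. 0)" by (auto simp: schmidt_op_def)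
    then have "(\<lambda>n. 0) \<in> characteristic_set I" using iff zero I by (simp add: operator_ideal_def)
    then show "(\<lambda>n. 0) \<in> ?\<Sigma>" using zero am by (auto intro!: bexI[of _ "\<lambda>n. 0"] exI[of _ 1])
  next
    fix \<xi> \<xi>' assume "\<xi> \<in> ?\<Sigma>" "\<xi>' \<in> ?\<Sigma>"
    then obtain \<eta> C \<eta>' C' where *: "\<xi> \<in> c0_star" "\<eta> \<in> characteristic_set I" "\<And>n. \<xi> n \<le> C * arith_mean \<eta> n"
      "\<xi>' \<in> c0_star" "\<eta>' \<in> characteristic_set I" "\<And>n. \<xi>' n \<le> C' * arith_mean \<eta>' n" by blast
    have "\<xi> n + \<xi>' n \<le> (\<bar>C\<bar> + \<bar>C'\<bar>) * arith_mean (\<lambda>n. \<eta> n + \<eta>' n) n" for n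
    proof -
      have "C * arith_mean \<eta> n \<le> (\<bar>C\<bar> + \<bar>C'\<bar>) * arith_mean \<eta> n"
        "C' * arith_mean \<eta>' n \<le> (\<bar>C\<bar> + \<bar>C'\<bar>) * arith_mean \<eta>' n"
        using am[OF *(2)] am[OF *(5)] by (intro mult_right_mono; simp)+
      then show ?thesis using *(3)[of n] *(6)[of n] unfolding arith_mean_add distrib_left by linarith
    qed
    moreover have "(\<lambda>n. \<xi> n + \<xi>' n) \<in> c0_star"
      using *(1,4) tendsto_add[OF c0_star_lim[OF *(1)] c0_star_lim[OF *(4)]]
      by (auto simp: c0_star_def decseq_def intro: add_mono)
    ultimately show "(\<lambda>n. \<xi> n + \<xi>' n) \<in> ?\<Sigma>"
      using characteristic_set_add[OF inf e I *(2,5)] by blast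
  next
    fix \<xi> \<eta> :: "nat \<Rightarrow> real" and C
    assume \<xi>: "\<xi> \<in> ?\<Sigma>" and \<eta>: "\<eta> \<in> c0_star" "\<And>n. \<eta> n \<le> C * \<xi> n"
    then obtain \<zeta> C' where *: "\<xi> \<in> c0_star" "\<zeta> \<in> characteristic_set I" "\<And>n. \<xi> n \<le> C' * arith_mean \<zeta> n" by blast
    have "\<eta> n \<le> (\<bar>C\<bar> * C') * arith_mean \<zeta> n" for n
    proof -
      have "\<eta> n \<le> \<bar>C\<bar> * \<xi> n"
        using \<eta>(2)[of n] mult_right_mono[OF abs_ge_self[of C] c0_star_nonneg[OF *(1), of n]] by linarith
      also have "\<dots> \<le> \<bar>C\<bar> * (C' * arith_mean \<zeta> n)" using *(3) by (intro mult_left_mono) auto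
      finally show ?thesis by (simp add: mult.assoc)
    qed
    then show "\<eta> \<in> ?\<Sigma>" using \<eta>(1) *(2) by blast
  next
    fix \<xi> assume "\<xi> \<in> ?\<Sigma>"
    then obtain \<eta> C where *: "\<xi> \<in> c0_star" "\<eta> \<in> characteristic_set I" "\<And>n. \<xi> n \<le> C * arith_mean \<eta> n" by blast
    have "\<xi> (n div 2) \<le> (\<bar>C\<bar> * 2) * arith_mean \<eta> n" for n
    proof -
      have "\<xi> (n div 2) \<le> \<bar>C\<bar> * arith_mean \<eta> (n div 2)"
        using *(3)[of "n div 2"] mult_right_mono[OF abs_ge_self[of C] am[OF *(2), of "n div 2"]] by linarith
      also have "\<dots> \<le> \<bar>C\<bar> * (2 * arith_mean \<eta> n)"
        using c0_star_nonneg[OF \<Sigma>I[OF *(2)]] by (intro mult_left_mono arith_mean_half_le) auto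
      finally show ?thesis by (simp add: mult.assoc)
    qed
    moreover have "(\<lambda>n. \<xi> (n div 2)) \<in> c0_star"
    proof -
      have "filterlim (\<lambda>n::nat. n div 2) at_top sequentially"
        unfolding filterlim_at_top eventually_sequentially
      proof
        show "\<exists>N. \<forall>n\<ge>N. Z \<le> n div 2" for Z :: nat by (intro exI[of _ "2 * Z"]) auto
      qed
      from filterlim_compose[OF c0_star_lim[OF *(1)] this] show ?thesis
        using *(1) by (auto simp: c0_star_def decseq_def div_le_mono)
    qed
    ultimately show "(\<lambda>n. \<xi> (n div 2)) \<in> ?\<Sigma>" using *(2) by blast
  qed
  then have "\<exists>!K :: ('a \<Rightarrow> 'a) set. operator_ideal K \<and> characteristic_set K = ?\<Sigma>"
    using ideal_eq_iff[OF inf sep] by metis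
  from theI'[OF this] show "operator_ideal (arith_mean_ideal I)" "characteristic_set (arith_mean_ideal I) = ?\<Sigma>"
    unfolding arith_mean_ideal_def by blast+
qed

text \<open>
  Iterating ideals amounts to iterating means of sequences, because the mean is monotone and
  homogeneous. The description starts at \<open>p = 1\<close>, the first step at which an \<open>O\<close>-bound is
  built in.
\<close>

lemma iterated_arith_mean_ideal:
  fixes I :: "('a::complex_hilbert \<Rightarrow> 'a) set"
  assumes inf: "infinite_dimensional TYPE('a)" and sep: "separable TYPE('a)"
    and I: "operator_ideal I"
  shows "operator_ideal ((arith_mean_ideal ^^ p) I) \<and>
    (p \<ge> 1 \<longrightarrow> characteristic_set ((arith_mean_ideal ^^ p) I) = dominated_by_means p (characteristic_set I))"
proof (induction p)
  case 0
  then show ?case using I by simp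
next
  case (Suc p)
  let ?K = "(arith_mean_ideal ^^ p) I"
  have K: "operator_ideal ?K" using Suc by blast
  obtain e :: "nat \<Rightarrow> 'a" where e: "orthonormal_basis e" using ex_orthonormal_basis[OF inf sep] by blast
  have \<Sigma>I: "\<eta> \<in> c0_star" if "\<eta> \<in> characteristic_set I" for \<eta>
    using characteristic_set_iff[OF inf e I] that by blast
  have char: "characteristic_set (arith_mean_ideal ?K) =
      {\<xi> \<in> c0_star. \<exists>\<eta>\<in>characteristic_set ?K. \<exists>C. \<forall>n. \<xi> n \<le> C * arith_mean \<eta> n}"
    by (rule arith_mean_ideal(2)[OF inf sep K])
  have "characteristic_set (arith_mean_ideal ?K) = dominated_by_means (Suc p) (characteristic_set I)"
  proof (cases "p = 0")
    case True
    then show ?thesis using char by (simp add: dominated_by_means_def)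
  next
    case False
    then have charK: "characteristic_set ?K = dominated_by_means p (characteristic_set I)" using Suc by simp
    show ?thesis
    proof (intro set_eqI iffI)
      fix \<xi> assume "\<xi> \<in> characteristic_set (arith_mean_ideal ?K)"
      then obtain \<zeta> C where \<xi>: "\<xi> \<in> c0_star" "\<zeta> \<in> dominated_by_means p (characteristic_set I)"
        "\<And>n. \<xi> n \<le> C * arith_mean \<zeta> n" unfolding char charK by blast
      then obtain \<eta> C' where \<eta>: "\<zeta> \<in> c0_star" "\<eta> \<in> characteristic_set I" "\<And>n. \<zeta> n \<le> C' * (arith_mean ^^ p) \<eta> n"
        unfolding dominated_by_means_def by blast
      have "\<xi> n \<le> (\<bar>C\<bar> * C') * (arith_mean ^^ Suc p) \<eta> n" for n
      proof -
        have "\<xi> n \<le> \<bar>C\<bar> * arith_mean \<zeta> n"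
          using \<xi>(3)[of n] mult_right_mono[OF abs_ge_self[of C] c0_star_nonneg[OF arith_mean_c0_star[OF \<eta>(1)], of n]]
          by linarith
        also have "\<dots> \<le> \<bar>C\<bar> * (C' * arith_mean ((arith_mean ^^ p) \<eta>) n)"
          using \<eta>(3) by (intro mult_left_mono arith_mean_le) auto
        finally show ?thesis by (simp add: mult.assoc)
      qed
      then show "\<xi> \<in> dominated_by_means (Suc p) (characteristic_set I)"
        unfolding dominated_by_means_def using \<xi>(1) \<eta>(2) by blast
    next
      fix \<xi> assume "\<xi> \<in> dominated_by_means (Suc p) (characteristic_set I)"
      then obtain \<eta> C where \<eta>: "\<xi> \<in> c0_star" "\<eta> \<in> characteristic_set I"
        "\<And>n. \<xi> n \<le> C * arith_mean ((arith_mean ^^ p) \<eta>) n"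
        unfolding dominated_by_means_def by auto
      have "(arith_mean ^^ p) \<eta> \<in> dominated_by_means p (characteristic_set I)"
        unfolding dominated_by_means_def using \<eta>(2) arith_mean_power_c0_star[OF \<Sigma>I[OF \<eta>(2)], of p]
        by (auto intro!: bexI[of _ \<eta>] exI[of _ 1])
      then show "\<xi> \<in> characteristic_set (arith_mean_ideal ?K)"
        unfolding char charK using \<eta>(1,3) by blast
    qed
  qed
  then show ?case using arith_mean_ideal(1)[OF inf sep K] by simp
qed

section \<open>Cancellation of an arithmetic mean\<close>

lemma le_abs_mult: "a \<le> C * b \<Longrightarrow> 0 \<le> b \<Longrightarrow> a \<le> \<bar>C\<bar> * (b :: real)"
  using mult_right_mono[OF abs_ge_self[of C], of b] by linarith

lemma arith_mean_partial_sums: "arith_mean \<gamma> (n - 1) = (\<Sum>j<n. \<gamma> j) / real n" if "n \<ge> 1"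
  using that by (cases n) (auto simp: arith_mean_def lessThan_Suc_atMost)

text \<open>
  With \<open>S\<^sub>m\<close> the partial sums of \<open>\<gamma>\<close>, the mean of \<open>\<gamma>\<close> is \<open>S\<^sub>m / m\<close>, so the second mean is
  governed by \<open>\<Sum> S\<^sub>m / m\<close>, the weighted sums compared above.
\<close>

lemma arith_mean_mean_partial_sums:
  "real (n + 1) * arith_mean (arith_mean \<gamma>) n = (\<Sum>m=1..n+1. (\<Sum>j<m. \<gamma> j) / real m)"
proof -
  have "(\<Sum>m=1..n+1. (\<Sum>j<m. \<gamma> j) / real m) = (\<Sum>i\<le>n. arith_mean \<gamma> i)"
    by (rule sum.reindex_bij_witness[of _ "\<lambda>i. i + 1" "\<lambda>m. m - 1"]) (auto simp: arith_mean_partial_sums[unfolded One_nat_def])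
  then show ?thesis by (simp only: arith_mean_times)
qed

lemma partial_sums_le_of_mean_means_le:
  assumes \<gamma>: "\<gamma> \<in> c0_star" and \<delta>: "\<delta> \<in> c0_star"
    and le: "\<And>n. arith_mean (arith_mean \<delta>) n \<le> C * arith_mean (arith_mean \<gamma>) n"
  shows "\<exists>D\<ge>0. \<forall>k\<ge>1. (\<Sum>j<k. \<delta> j) \<le> D * (\<Sum>j<k\<^sup>2. \<gamma> j)"
proof (rule weighted_sums_comparison)
  show "mono (\<lambda>n. \<Sum>j<n. \<gamma> j)" "mono (\<lambda>n. \<Sum>j<n. \<delta> j)"
    using c0_star_nonneg[OF \<gamma>] c0_star_nonneg[OF \<delta>] by (auto intro!: monoI sum_mono2)
  show "0 \<le> (\<Sum>j<n. \<gamma> j)" "0 \<le> (\<Sum>j<n. \<delta> j)" for n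
    using c0_star_nonneg[OF \<gamma>] c0_star_nonneg[OF \<delta>] by (auto intro!: sum_nonneg)
  show "(\<Sum>m=1..n. (\<Sum>j<m. \<delta> j) / real m) \<le> C * (\<Sum>m=1..n. (\<Sum>j<m. \<gamma> j) / real m)" for n
  proof (cases n)
    case (Suc i)
    have "real (i + 1) * arith_mean (arith_mean \<delta>) i \<le> real (i + 1) * (C * arith_mean (arith_mean \<gamma>) i)"
      using le by (intro mult_left_mono) auto
    also have "\<dots> = C * (real (i + 1) * arith_mean (arith_mean \<gamma>) i)" by simp
    finally show ?thesis unfolding arith_mean_mean_partial_sums Suc by simp
  qed simp
qed

lemma arith_mean_power_0: "(arith_mean ^^ p) \<eta> 0 = \<eta> 0"
  by (induction p) (auto simp: arith_mean_def)

text \<open>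
  Write \<open>\<eta>\<^sub>p\<close> for the \<open>p\<close>-fold mean of \<open>\<eta>\<close>. Since \<open>m (\<eta>\<^sub>p)\<^sub>m\<close> is the \<open>m\<close>-th partial sum of
  the mean of order \<open>p - 1\<close>, the exponential \<open>\<Delta>\<^sub>2\<close>-condition says that these partial sums
  grow by a bounded factor when the index is squared.
\<close>

lemma exp_Delta2_partial_sums:
  assumes \<eta>: "\<eta> \<in> c0_star" "\<eta> \<noteq> (\<lambda>n. 0)" and exp: "exp_Delta2 (Suc q) \<eta>"
  shows "\<exists>K\<ge>0. \<forall>k\<ge>1. (\<Sum>j<k\<^sup>2. (arith_mean ^^ q) \<eta> j) \<le> K * (\<Sum>j<k. (arith_mean ^^ q) \<eta> j)"
proof -
  define \<gamma> where "\<gamma> = (arith_mean ^^ q) \<eta>"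
  define S where "S k = (\<Sum>j<k. \<gamma> j)" for k
  have \<gamma>: "\<gamma> \<in> c0_star" unfolding \<gamma>_def by (rule arith_mean_power_c0_star[OF \<eta>(1)])
  have "\<eta> 0 \<noteq> 0"
  proof
    assume "\<eta> 0 = 0"
    then have "\<eta> n = 0" for n using c0_star_nonneg[OF \<eta>(1), of n] c0_star_antimono[OF \<eta>(1), of 0 n] by simp
    with \<eta>(2) show False by auto
  qed
  then have "\<gamma> 0 > 0" using c0_star_nonneg[OF \<gamma>, of 0] by (auto simp: \<gamma>_def arith_mean_power_0)
  have S: "S k > 0" if "k \<ge> 1" for k
  proof -
    have "\<gamma> 0 \<le> S k" unfolding S_def using that c0_star_nonneg[OF \<gamma>] by (intro member_le_sum) auto
    with \<open>\<gamma> 0 > 0\<close> show ?thesis by linarith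
  qed
  obtain K where K: "\<And>m. m \<ge> 1 \<Longrightarrow>
      real (m\<^sup>2) * arith_mean \<gamma> (m\<^sup>2 - 1) / (real m * arith_mean \<gamma> (m - 1)) \<le> K"
    using exp unfolding exp_Delta2_def bdd_above_def \<gamma>_def by auto
  have "S (k\<^sup>2) \<le> \<bar>K\<bar> * S k" if k: "k \<ge> 1" for k
  proof -
    have "real (k\<^sup>2) * arith_mean \<gamma> (k\<^sup>2 - 1) = S (k\<^sup>2)" "real k * arith_mean \<gamma> (k - 1) = S k"
      using k arith_mean_partial_sums[of k \<gamma>] arith_mean_partial_sums[of "k\<^sup>2" \<gamma>] by (simp_all add: S_def)
    then have "S (k\<^sup>2) / S k \<le> K" using K[OF k] by simp
    then have "S (k\<^sup>2) \<le> K * S k" using S[OF k] by (simp add: divide_le_eq)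
    then show ?thesis using S[OF k] by (intro le_abs_mult) auto
  qed
  then show ?thesis unfolding S_def \<gamma>_def by (intro exI[of _ "\<bar>K\<bar>"]) auto
qed

context
  fixes \<eta> \<rho> :: "nat \<Rightarrow> real" and p :: nat
  assumes \<eta>: "\<eta> \<in> c0_star" "\<eta> \<noteq> (\<lambda>n. 0)" and \<rho>: "\<rho> \<in> c0_star"
    and p: "p \<ge> 1" and exp: "exp_Delta2 p \<eta>"
begin

text \<open>
  The bound by squares has the slow sequence on the smaller side, at the index \<open>k\<close>; slow
  growth is used to raise that index up to \<open>k\<^sup>4\<close>, beyond the gap between consecutive
  squares.
\<close>

lemma mean_le_cancel_left:
  assumes le: "\<And>n. (arith_mean ^^ (p + 1)) \<eta> n \<le> C * (arith_mean ^^ (p + 1)) \<rho> n"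
  shows "\<exists>E. \<forall>n. (arith_mean ^^ p) \<eta> n \<le> E * (arith_mean ^^ p) \<rho> n"
proof -
  obtain q where q: "p = Suc q" using p by (cases p) auto
  define \<gamma> \<delta> where "\<gamma> = (arith_mean ^^ q) \<eta>" and "\<delta> = (arith_mean ^^ q) \<rho>"
  have \<gamma>: "\<gamma> \<in> c0_star" and \<delta>: "\<delta> \<in> c0_star"
    unfolding \<gamma>_def \<delta>_def using \<eta> \<rho> arith_mean_power_c0_star by blast+
  obtain D where D: "D \<ge> 0" "\<And>k. k \<ge> 1 \<Longrightarrow> (\<Sum>j<k. \<gamma> j) \<le> D * (\<Sum>j<k\<^sup>2. \<delta> j)"
    using partial_sums_le_of_mean_means_le[OF \<delta> \<gamma>, of C] le unfolding \<gamma>_def \<delta>_def q by auto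
  obtain K where K: "K \<ge> 0" "\<And>k. k \<ge> 1 \<Longrightarrow> (\<Sum>j<k\<^sup>2. \<gamma> j) \<le> K * (\<Sum>j<k. \<gamma> j)"
    using exp_Delta2_partial_sums[OF \<eta>] exp unfolding \<gamma>_def q by blast
  have "(\<Sum>j<n. \<gamma> j) \<le> real n * (\<Sum>j<1. \<gamma> j)" for n
    using sum_bounded_above[of "{..<n}" \<gamma> "\<gamma> 0"] c0_star_antimono[OF \<gamma>] by simp
  then obtain E where E: "\<And>n. n \<ge> 1 \<Longrightarrow> (\<Sum>j<n. \<gamma> j) \<le> E * (\<Sum>j<n. \<delta> j)"
    using comparison_from_squares[of "\<lambda>n. \<Sum>j<n. \<gamma> j" "\<lambda>n. \<Sum>j<n. \<delta> j" D K] D K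
      c0_star_nonneg[OF \<gamma>] c0_star_nonneg[OF \<delta>]
    by (auto simp: mono_def sum_mono2 sum_nonneg)
  have "arith_mean \<gamma> n \<le> E * arith_mean \<delta> n" for n
    using divide_right_mono[OF E[of "n + 1"], of "real (n + 1)"] arith_mean_partial_sums[of "n + 1"] by simp
  then show ?thesis by (auto simp: q \<gamma>_def \<delta>_def)
qed

text \<open>
  The bound by squares has the slow sequence on the larger side, at the index \<open>k\<^sup>2\<close>; one use
  of slow growth brings it back to \<open>k\<close>.
\<close>

lemma mean_le_cancel_right:
  assumes le: "\<And>n. (arith_mean ^^ (p + 1)) \<rho> n \<le> C * (arith_mean ^^ (p + 1)) \<eta> n"
  shows "\<exists>E. \<forall>n. (arith_mean ^^ p) \<rho> n \<le> E * (arith_mean ^^ p) \<eta> n"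
proof -
  obtain q where q: "p = Suc q" using p by (cases p) auto
  define \<gamma> \<delta> where "\<gamma> = (arith_mean ^^ q) \<eta>" and "\<delta> = (arith_mean ^^ q) \<rho>"
  have \<gamma>: "\<gamma> \<in> c0_star" and \<delta>: "\<delta> \<in> c0_star"
    unfolding \<gamma>_def \<delta>_def using \<eta> \<rho> arith_mean_power_c0_star by blast+
  obtain D where D: "D \<ge> 0" "\<And>k. k \<ge> 1 \<Longrightarrow> (\<Sum>j<k. \<delta> j) \<le> D * (\<Sum>j<k\<^sup>2. \<gamma> j)"
    using partial_sums_le_of_mean_means_le[OF \<gamma> \<delta>, of C] le unfolding \<gamma>_def \<delta>_def q by auto
  obtain K where K: "K \<ge> 0" "\<And>k. k \<ge> 1 \<Longrightarrow> (\<Sum>j<k\<^sup>2. \<gamma> j) \<le> K * (\<Sum>j<k. \<gamma> j)"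
    using exp_Delta2_partial_sums[OF \<eta>] exp unfolding \<gamma>_def q by blast
  have E: "(\<Sum>j<k. \<delta> j) \<le> D * K * (\<Sum>j<k. \<gamma> j)" if "k \<ge> 1" for k
    using order_trans[OF D(2)[OF that] mult_left_mono[OF K(2)[OF that] D(1)]] by (simp add: mult.assoc)
  have "arith_mean \<delta> n \<le> D * K * arith_mean \<gamma> n" for n
    using divide_right_mono[OF E[of "n + 1"], of "real (n + 1)"] arith_mean_partial_sums[of "n + 1"] by simp
  then show ?thesis by (auto simp: q \<gamma>_def \<delta>_def)
qed

end

theorem theorem4p9:
  fixes I :: "('a::complex_hilbert \<Rightarrow> 'a) set" and p :: nat
  assumes "infinite_dimensional TYPE('a)" and "separable TYPE('a)"
    and "p \<ge> 1"
    and "operator_ideal I"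
    and "\<forall>\<xi>\<in>characteristic_set I. \<exists>\<eta>\<in>characteristic_set I.
           \<eta> \<noteq> (\<lambda>n. 0) \<and> (\<forall>n. \<xi> n \<le> \<eta> n) \<and> exp_Delta2 p \<eta>"
  shows "\<forall>J :: ('a \<Rightarrow> 'a) set. operator_ideal J \<longrightarrow>
     ((arith_mean_ideal ^^ (p + 1)) I \<subseteq> (arith_mean_ideal ^^ (p + 1)) J \<longrightarrow>
        (arith_mean_ideal ^^ p) I \<subseteq> (arith_mean_ideal ^^ p) J) \<and>
     ((arith_mean_ideal ^^ (p + 1)) J \<subseteq> (arith_mean_ideal ^^ (p + 1)) I \<longrightarrow>
        (arith_mean_ideal ^^ p) J \<subseteq> (arith_mean_ideal ^^ p) I) \<and>
     ((arith_mean_ideal ^^ (p + 1)) J = (arith_mean_ideal ^^ (p + 1)) I \<longrightarrow>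
        (arith_mean_ideal ^^ p) J = (arith_mean_ideal ^^ p) I)"
proof (intro allI impI)
  fix J :: "('a \<Rightarrow> 'a) set"
  assume J: "operator_ideal J"
  note hilbert = assms(1,2) and p = assms(3) and I = assms(4)
  obtain e :: "nat \<Rightarrow> 'a" where e: "orthonormal_basis e" using ex_orthonormal_basis[OF hilbert] by blast
  have c0: "\<eta> \<in> c0_star" if "\<eta> \<in> characteristic_set L" "operator_ideal L" for \<eta> and L :: "('a \<Rightarrow> 'a) set"
    using characteristic_set_iff[OF assms(1) e that(2)] that(1) by blast
  let ?dom = "\<lambda>k L. dominated_by_means k (characteristic_set L)"
  have subset: "(arith_mean_ideal ^^ k) L \<subseteq> (arith_mean_ideal ^^ k) M \<longleftrightarrow> ?dom k L \<subseteq> ?dom k M"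
    if "operator_ideal L" "operator_ideal M" "k \<ge> 1" for L M :: "('a \<Rightarrow> 'a) set" and k
    using iterated_arith_mean_ideal[OF hilbert that(1), of k] iterated_arith_mean_ideal[OF hilbert that(2), of k]
      ideal_subset_iff[OF hilbert] that(3) by metis
  have mem: "(arith_mean ^^ k) \<eta> \<in> ?dom k L" if "\<eta> \<in> characteristic_set L" "operator_ideal L"
    for \<eta> k and L :: "('a \<Rightarrow> 'a) set"
    unfolding dominated_by_means_def using that arith_mean_power_c0_star[OF c0[OF that], of k]
    by (auto intro!: bexI[of _ \<eta>] exI[of _ 1])
  have nonneg: "0 \<le> (arith_mean ^^ k) \<eta> n" if "\<eta> \<in> c0_star" for k \<eta> n
    using c0_star_nonneg[OF arith_mean_power_c0_star[OF that]] .
  \<comment> \<open>The hypothesis dominates \<open>\<eta>\<close> itself; monotonicity of the mean dominates all of its iterated means.\<close>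
  have good: "\<exists>\<eta>'\<in>characteristic_set I. \<eta>' \<noteq> (\<lambda>n. 0) \<and> exp_Delta2 p \<eta>' \<and>
      (\<forall>k n. (arith_mean ^^ k) \<eta> n \<le> (arith_mean ^^ k) \<eta>' n)" if "\<eta> \<in> characteristic_set I" for \<eta>
    using assms(5) that arith_mean_power_le by meson
  have up: "?dom p I \<subseteq> ?dom p J" if sub: "?dom (p + 1) I \<subseteq> ?dom (p + 1) J"
  proof
    fix \<xi> assume "\<xi> \<in> ?dom p I"
    then obtain \<eta> C where \<xi>: "\<xi> \<in> c0_star" "\<eta> \<in> characteristic_set I" "\<And>n. \<xi> n \<le> C * (arith_mean ^^ p) \<eta> n"
      unfolding dominated_by_means_def by blast
    obtain \<eta>' where \<eta>': "\<eta>' \<in> characteristic_set I" "\<eta>' \<noteq> (\<lambda>n. 0)" "exp_Delta2 p \<eta>'"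
      "\<And>k n. (arith_mean ^^ k) \<eta> n \<le> (arith_mean ^^ k) \<eta>' n" using good[OF \<xi>(2)] by blast
    have "(arith_mean ^^ (p + 1)) \<eta>' \<in> ?dom (p + 1) J" using mem[OF \<eta>'(1) I] sub by blast
    then obtain \<rho> D where \<rho>: "\<rho> \<in> characteristic_set J"
      "\<And>n. (arith_mean ^^ (p + 1)) \<eta>' n \<le> D * (arith_mean ^^ (p + 1)) \<rho> n"
      unfolding dominated_by_means_def by blast
    obtain E where E: "\<And>n. (arith_mean ^^ p) \<eta>' n \<le> E * (arith_mean ^^ p) \<rho> n"
      using mean_le_cancel_left[OF c0[OF \<eta>'(1) I] \<eta>'(2) c0[OF \<rho>(1) J] p \<eta>'(3) \<rho>(2)] by blast
    have "\<xi> n \<le> \<bar>C\<bar> * E * (arith_mean ^^ p) \<rho> n" for n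
    proof -
      have "\<xi> n \<le> \<bar>C\<bar> * (arith_mean ^^ p) \<eta> n"
        using \<xi>(3) nonneg[OF c0[OF \<xi>(2) I]] by (rule le_abs_mult)
      also have "\<dots> \<le> \<bar>C\<bar> * (E * (arith_mean ^^ p) \<rho> n)"
        using \<eta>'(4)[of p n] E[of n] by (intro mult_left_mono) auto
      finally show ?thesis by (simp add: mult.assoc)
    qed
    then show "\<xi> \<in> ?dom p J" unfolding dominated_by_means_def using \<xi>(1) \<rho>(1) by blast
  qed
  have down: "?dom p J \<subseteq> ?dom p I" if sub: "?dom (p + 1) J \<subseteq> ?dom (p + 1) I"
  proof
    fix \<xi> assume "\<xi> \<in> ?dom p J"
    then obtain \<rho> C where \<xi>: "\<xi> \<in> c0_star" "\<rho> \<in> characteristic_set J" "\<And>n. \<xi> n \<le> C * (arith_mean ^^ p) \<rho> n"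
      unfolding dominated_by_means_def by blast
    have "(arith_mean ^^ (p + 1)) \<rho> \<in> ?dom (p + 1) I" using mem[OF \<xi>(2) J] sub by blast
    then obtain \<eta> D where \<eta>: "\<eta> \<in> characteristic_set I"
      "\<And>n. (arith_mean ^^ (p + 1)) \<rho> n \<le> D * (arith_mean ^^ (p + 1)) \<eta> n"
      unfolding dominated_by_means_def by blast
    obtain \<eta>' where \<eta>': "\<eta>' \<in> characteristic_set I" "\<eta>' \<noteq> (\<lambda>n. 0)" "exp_Delta2 p \<eta>'"
      "\<And>k n. (arith_mean ^^ k) \<eta> n \<le> (arith_mean ^^ k) \<eta>' n" using good[OF \<eta>(1)] by blast
    have "(arith_mean ^^ (p + 1)) \<rho> n \<le> \<bar>D\<bar> * (arith_mean ^^ (p + 1)) \<eta>' n" for n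
      using le_abs_mult[OF \<eta>(2) nonneg[OF c0[OF \<eta>(1) I]], of n] mult_left_mono[OF \<eta>'(4) abs_ge_zero[of D]]
      by (rule order_trans)
    then obtain E where E: "\<And>n. (arith_mean ^^ p) \<rho> n \<le> E * (arith_mean ^^ p) \<eta>' n"
      using mean_le_cancel_right[OF c0[OF \<eta>'(1) I] \<eta>'(2) c0[OF \<xi>(2) J] p \<eta>'(3)] by blast
    have "\<xi> n \<le> \<bar>C\<bar> * E * (arith_mean ^^ p) \<eta>' n" for n
    proof -
      have "\<xi> n \<le> \<bar>C\<bar> * (arith_mean ^^ p) \<rho> n"
        using \<xi>(3) nonneg[OF c0[OF \<xi>(2) J]] by (rule le_abs_mult)
      also have "\<dots> \<le> \<bar>C\<bar> * (E * (arith_mean ^^ p) \<eta>' n)" using E by (intro mult_left_mono) auto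
      finally show ?thesis by (simp add: mult.assoc)
    qed
    then show "\<xi> \<in> ?dom p I" unfolding dominated_by_means_def using \<xi>(1) \<eta>'(1) by blast
  qed
  have p1: "p + 1 \<ge> 1" by simp
  have up': "(arith_mean_ideal ^^ p) I \<subseteq> (arith_mean_ideal ^^ p) J"
    if "(arith_mean_ideal ^^ (p + 1)) I \<subseteq> (arith_mean_ideal ^^ (p + 1)) J"
    using that up unfolding subset[OF I J p] subset[OF I J p1] by blast
  have down': "(arith_mean_ideal ^^ p) J \<subseteq> (arith_mean_ideal ^^ p) I"
    if "(arith_mean_ideal ^^ (p + 1)) J \<subseteq> (arith_mean_ideal ^^ (p + 1)) I"
    using that down unfolding subset[OF J I p] subset[OF J I p1] by blast
  show "((arith_mean_ideal ^^ (p + 1)) I \<subseteq> (arith_mean_ideal ^^ (p + 1)) J \<longrightarrow>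
        (arith_mean_ideal ^^ p) I \<subseteq> (arith_mean_ideal ^^ p) J) \<and>
     ((arith_mean_ideal ^^ (p + 1)) J \<subseteq> (arith_mean_ideal ^^ (p + 1)) I \<longrightarrow>
        (arith_mean_ideal ^^ p) J \<subseteq> (arith_mean_ideal ^^ p) I) \<and>
     ((arith_mean_ideal ^^ (p + 1)) J = (arith_mean_ideal ^^ (p + 1)) I \<longrightarrow>
        (arith_mean_ideal ^^ p) J = (arith_mean_ideal ^^ p) I)"
    using up' down' by blast
qed

end
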